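(* Let $j\ge 3$ be an integer, and let $g,\delta$ be positive integers with $\delta\ge 3$ such that there exists a Moore graph of girth $g$ and minimum degree $\delta$. Then there exists a $\delta$-regular graph with girth $g$, equator $q=jg$ and order $n=\frac{q}{g}M(\delta,g)$.
   Context: For integers $\delta\ge 2$, $g\ge 3$, with $k=\lceil g/2\rceil-1$, the Moore bound is $M(\delta,g)=1+\sum_{i=0}^{k-1}\delta(\delta-1)^i$ if $g$ is odd and $M(\delta,g)=2+\sum_{i=1}^{k}2(\delta-1)^i$ if $g$ is even. A Moore graph of girth $g$ and minimum degree $\delta$ is a graph with girth $g$, minimum degree $\delta$ and exactly $M(\delta,g)$ vertices. A cycle $C$ in a graph $G$ is isometric if $d_C(x,y)=d_G(x,y)$ for all $x,y\in V(C)$; the equator of $G$ is the length of a longest isometric cycle. *)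

theory Defs
  imports "Graph_Theory.Graph_Theory" "HOL-Library.Extended_Nat" Complex_Main
begin

(* Finite simple graphs are the symmetric loop-free digraphs of the locale pair_graph: an edge
   {u,v} is the pair of arcs (u,v), (v,u), so the degree of a vertex is its out-degree. *)

definition regular :: "nat \<Rightarrow> 'a pair_pre_digraph \<Rightarrow> bool" where
  "regular d G \<longleftrightarrow> (\<forall>v\<in>pverts G. out_degree (with_proj G) v = d)"

definition min_degree :: "'a pair_pre_digraph \<Rightarrow> nat" where
  "min_degree G = Min (out_degree (with_proj G) ` pverts G)"

definition graph_dist :: "'a pair_pre_digraph \<Rightarrow> 'a \<Rightarrow> 'a \<Rightarrow> enat" where
  "graph_dist G u v = (INF p\<in>{p. pre_digraph.awalk (with_proj G) u p v}. enat (length p))"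

definition cycle_graph :: "'a list \<Rightarrow> 'a pair_pre_digraph" where
  "cycle_graph xs =
     (let A = {(xs ! i, xs ! (Suc i mod length xs)) | i. i < length xs}
      in \<lparr>pverts = set xs, parcs = A \<union> A\<inverse>\<rparr>)"

(* Cycles are subgraphs, with at least three vertices; pre_digraph.cycle would also
   admit the closed walk u, v, u. *)
definition cycles :: "'a pair_pre_digraph \<Rightarrow> 'a pair_pre_digraph set" where
  "cycles G = {cycle_graph xs | xs. distinct xs \<and> 3 \<le> length xs \<and>
                 subgraph (with_proj (cycle_graph xs)) (with_proj G)}"

(* The number of vertices of a cycle equals its number of edges. *)
definition cycle_length :: "'a pair_pre_digraph \<Rightarrow> nat" where
  "cycle_length C = card (pverts C)"

(* The girth of a graph without cycles is infinite. *)
definition girth :: "'a pair_pre_digraph \<Rightarrow> enat" where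
  "girth G = (INF C\<in>cycles G. enat (cycle_length C))"

definition isometric_cycle :: "'a pair_pre_digraph \<Rightarrow> 'a pair_pre_digraph \<Rightarrow> bool" where
  "isometric_cycle G C \<longleftrightarrow>
     C \<in> cycles G \<and> (\<forall>x\<in>pverts C. \<forall>y\<in>pverts C. graph_dist C x y = graph_dist G x y)"

(* Only meaningful for finite graphs containing a cycle: a shortest cycle is isometric, so the
   set below is then finite and nonempty. *)
definition equator :: "'a pair_pre_digraph \<Rightarrow> nat" where
  "equator G = Max {cycle_length C | C. isometric_cycle G C}"

definition moore_bound :: "nat \<Rightarrow> nat \<Rightarrow> nat" where
  "moore_bound \<delta> g =
     (let k = nat (\<lceil>real g / 2\<rceil> - 1)
      in if odd g then 1 + (\<Sum>i=0..<k. \<delta> * (\<delta> - 1) ^ i)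
         else 2 + (\<Sum>i=1..k. 2 * (\<delta> - 1) ^ i))"

definition moore_graph :: "nat \<Rightarrow> nat \<Rightarrow> 'a pair_pre_digraph \<Rightarrow> bool" where
  "moore_graph \<delta> g G \<longleftrightarrow>
     pair_graph G \<and> girth G = enat g \<and> min_degree G = \<delta> \<and> card (pverts G) = moore_bound \<delta> g"

end

(* Moore graphs: for a vertex w (g odd) or an edge wx (g even) the non-backtracking walks of bounded
   length have different ends, because two walks with the same ends would close up to a cycle shorter
   than g. Counting them gives the Moore bound, and equality forces the graph to be delta-regular
   with diameter at most g div 2 and every edge to lie on a cycle of length g.

   Construction: choose a g-cycle c and an edge uv off c at a vertex of c. Delete uv from each of j
   disjoint copies of the Moore graph and join v in copy i to u in copy i + 1, cyclically. The cycle c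
   survives. A cycle through one of the new edges must pass through all copies, and inside each copy
   it needs at least g - 1 edges to get from u to v, so it has length at least jg; running along a
   shortest u-v-path in every copy gives a cycle of length jg that is a retract, hence isometric.
   Conversely, an isometric cycle through a new edge cannot spend more than g - 1 edges inside a copy,
   and an isometric cycle inside one copy has length at most 3g - 3, because a copy without uv
   has diameter at most g div 2 + g - 2. *)

theory Submission
  imports Defs
begin

section \<open>Non-backtracking walks and girth\<close>

text \<open>Cycles are kept as bare vertex lists, which can be rotated, mapped and indexed;
  \<open>cycles_eq\<close> links them to the subgraphs in \<open>cycles\<close>.\<close>

definition cyc :: "'a rel \<Rightarrow> 'a list \<Rightarrow> bool" where
  "cyc E xs \<longleftrightarrow> distinct xs \<and> 3 \<le> length xs \<and>
     (\<forall>i<length xs. (xs ! i, xs ! (Suc i mod length xs)) \<in> E)"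

text \<open>Lists with fewer than two entries count as walks whatever they contain, so membership in
  the vertex set follows only from length two on.\<close>

fun nonbacktracking :: "'a rel \<Rightarrow> 'a list \<Rightarrow> bool" where
  "nonbacktracking E (x # y # z # r) \<longleftrightarrow> (x, y) \<in> E \<and> x \<noteq> z \<and> nonbacktracking E (y # z # r)"
| "nonbacktracking E [x, y] \<longleftrightarrow> (x, y) \<in> E"
| "nonbacktracking E _ \<longleftrightarrow> True"

lemma nonbacktracking_tl: "nonbacktracking E (x # p) \<Longrightarrow> nonbacktracking E p"
  by (induction E "x # p" rule: nonbacktracking.induct) auto

lemma nonbacktracking_Cons_Cons:
  "nonbacktracking E (x # y # r) \<longleftrightarrow>
     (x, y) \<in> E \<and> (r \<noteq> [] \<longrightarrow> x \<noteq> hd r) \<and> nonbacktracking E (y # r)"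
  by (cases r) auto

lemma nonbacktracking_join:
  assumes "nonbacktracking E (xs @ [a])" "nonbacktracking E (a # ys)"
    and "xs \<noteq> [] \<Longrightarrow> ys \<noteq> [] \<Longrightarrow> last xs \<noteq> hd ys"
  shows "nonbacktracking E (xs @ a # ys)"
  using assms
proof (induction xs)
  case (Cons x xs)
  have "nonbacktracking E (xs @ a # ys)"
    using Cons.IH Cons.prems nonbacktracking_tl[of E x "xs @ [a]"] by (cases xs) auto
  then show ?case
    using Cons.prems
    by (cases xs; cases "tl xs") (auto simp: nonbacktracking_Cons_Cons)
qed simp

lemma nonbacktracking_append1: "nonbacktracking E (xs @ ys) \<Longrightarrow> nonbacktracking E xs"
proof (induction xs)
  case (Cons x xs)
  then show ?case
    using nonbacktracking_tl[of E x "xs @ ys"]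
    by (cases xs; cases "tl xs") (auto simp: nonbacktracking_Cons_Cons)
qed simp

lemma nonbacktracking_append2: "nonbacktracking E (xs @ ys) \<Longrightarrow> nonbacktracking E ys"
  by (induction xs) (auto dest: nonbacktracking_tl)

lemma nonbacktracking_rev:
  "sym E \<Longrightarrow> nonbacktracking E p \<Longrightarrow> nonbacktracking E (rev p)"
proof (induction E p rule: nonbacktracking.induct)
  case (1 E x y z r)
  have "nonbacktracking E ((rev r @ [z]) @ y # [x])"
    by (rule nonbacktracking_join) (use 1 in \<open>auto dest: symD\<close>)
  then show ?case by simp
qed (auto dest: symD)

lemma nonbacktracking_successive:
  "nonbacktracking E p \<Longrightarrow> Suc i < length p \<Longrightarrow> (p ! i, p ! Suc i) \<in> E"
proof (induction p arbitrary: i)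
  case (Cons x p)
  show ?case
  proof (cases i)
    case 0
    then show ?thesis using Cons.prems by (cases p) (auto simp: nonbacktracking_Cons_Cons)
  next
    case (Suc i')
    then show ?thesis using Cons.IH[of i'] Cons.prems nonbacktracking_tl[of E x p] by auto
  qed
qed simp

lemma relpow_list:
  assumes "p \<noteq> []" "\<And>i. Suc i < length p \<Longrightarrow> (p ! i, p ! Suc i) \<in> R"
  shows "(hd p, last p) \<in> R ^^ (length p - 1)"
  unfolding relpow_fun_conv
  by (rule exI[of _ "\<lambda>i. p ! i"]) (use assms in \<open>auto simp: hd_conv_nth last_conv_nth\<close>)

lemma nonbacktracking_relpow:
  assumes "nonbacktracking E p" "p \<noteq> []"
  shows "(hd p, last p) \<in> (E \<inter> set p \<times> set p) ^^ (length p - 1)"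
  by (rule relpow_list) (use assms nonbacktracking_successive[of E p] in auto)

lemma relpow_mono': "(R :: 'a rel) \<subseteq> S \<Longrightarrow> (x, y) \<in> R ^^ n \<Longrightarrow> (x, y) \<in> S ^^ n"
  by (induction n arbitrary: y) auto

lemma relpow_sym: "sym R \<Longrightarrow> (x, y) \<in> R ^^ n \<Longrightarrow> (y, x) \<in> R ^^ n"
proof (induction n arbitrary: y)
  case (Suc n)
  then obtain z where "(x, z) \<in> R ^^ n" "(z, y) \<in> R" by auto
  then show ?case using Suc by (meson relpow_Suc_I2 symD)
qed auto

section \<open>Simple graphs as symmetric relations, and the growth of branches\<close>

locale simple_graph =
  fixes V :: "'a set" and E :: "'a rel"
  assumes finite_V: "finite V" and E_subset: "E \<subseteq> V \<times> V"
    and sym_E: "sym E" and irrefl_E: "irrefl E"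
begin

lemma E_sym: "(x, y) \<in> E \<Longrightarrow> (y, x) \<in> E"
  using sym_E by (rule symD)

lemma E_neq: "(x, y) \<in> E \<Longrightarrow> x \<noteq> y"
  using irrefl_E by (auto simp: irrefl_def)

lemma E_in_V: "(x, y) \<in> E \<Longrightarrow> x \<in> V \<and> y \<in> V"
  using E_subset by auto

lemma finite_neighbours: "finite (E `` {x})"
  by (rule finite_subset[OF _ finite_V]) (auto dest: E_in_V)

text \<open>A walk \<open>w\<close> = \<open>hd p\<close>, \<dots>, \<open>u\<close> of length \<open>n\<close> is stored backwards; appending
  \<open>v\<close> records that the arc \<open>(u, v)\<close> is excluded as its first step from \<open>u\<close>.\<close>

definition branch :: "'a \<Rightarrow> 'a \<Rightarrow> nat \<Rightarrow> 'a list set" where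
  "branch u v n = {p. nonbacktracking E (p @ [v]) \<and> length p = Suc n \<and> last p = u}"

lemma branch_nonbacktracking: "p \<in> branch u v n \<Longrightarrow> nonbacktracking E p"
  by (auto simp: branch_def dest: nonbacktracking_append1)

lemma branch_append: "p \<in> branch u v n \<Longrightarrow> nonbacktracking E (p @ [v])"
  by (simp add: branch_def)

lemma branch_ne: "p \<in> branch u v n \<Longrightarrow> p \<noteq> []"
  by (auto simp: branch_def)

lemma branch_last: "p \<in> branch u v n \<Longrightarrow> last p = u"
  by (auto simp: branch_def)

lemma branch_length: "p \<in> branch u v n \<Longrightarrow> length p = Suc n"
  by (auto simp: branch_def)

lemma nonbacktracking_set_V:
  assumes "nonbacktracking E p" "2 \<le> length p"
  shows "set p \<subseteq> V"
proof
  fix x assume "x \<in> set p"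
  then obtain i where "i < length p" "x = p ! i" by (auto simp: in_set_conv_nth)
  then show "x \<in> V"
    using nonbacktracking_successive[OF assms(1), of i]
      nonbacktracking_successive[OF assms(1), of "i - 1"] assms(2) E_in_V
    by (cases "Suc i < length p"; cases i) auto
qed

lemma branch_set: "p \<in> branch u v n \<Longrightarrow> set p \<subseteq> V"
  using nonbacktracking_set_V[of "p @ [v]"] by (auto simp: branch_def)

lemma finite_branch: "finite (branch u v n)"
  by (rule finite_subset[OF _ finite_lists_length_eq[OF finite_V, of "Suc n"]])
    (use branch_set branch_length in blast)

lemma branch_0: "(u, v) \<in> E \<Longrightarrow> branch u v 0 = {[u]}"
  by (auto simp: branch_def length_Suc_conv)

text \<open>A walk extends at its head by every neighbour except the vertex it has just come from.
  For \<open>n = 0\<close> that vertex is the recorded \<open>v\<close>;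
  \<open>hd (tl (p @ [v]))\<close> serves both cases.\<close>

lemma card_branch_Suc:
  "(\<Sum>p\<in>branch u v n. card (E `` {hd p}) - 1) \<le> card (branch u v (Suc n))"
proof -
  let ?B = "\<lambda>p. E `` {hd p} - {hd (tl (p @ [v]))}"
  have "(\<Sum>p\<in>branch u v n. card (E `` {hd p}) - 1) \<le> (\<Sum>p\<in>branch u v n. card (?B p))"
    by (intro sum_mono) (simp add: card_Diff_singleton_if finite_neighbours)
  also have "\<dots> = card (SIGMA p:branch u v n. ?B p)"
    by (simp add: finite_branch finite_neighbours)
  also have "\<dots> \<le> card (branch u v (Suc n))"
  proof (rule card_inj_on_le)
    show "inj_on (\<lambda>(p, z). z # p) (SIGMA p:branch u v n. ?B p)"
      by (auto simp: inj_on_def)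
    show "(\<lambda>(p, z). z # p) ` (SIGMA p:branch u v n. ?B p) \<subseteq> branch u v (Suc n)"
    proof (rule image_subsetI)
      fix x assume "x \<in> (SIGMA p:branch u v n. ?B p)"
      then obtain p z where x: "x = (p, z)" and p: "p \<in> branch u v n"
        and z: "(hd p, z) \<in> E" "z \<noteq> hd (tl (p @ [v]))" by blast
      obtain y r where [simp]: "p = y # r" using branch_ne[OF p] by (cases p) auto
      show "(case x of (p, z) \<Rightarrow> z # p) \<in> branch u v (Suc n)"
        using x p z E_sym[OF z(1)] by (auto simp: branch_def nonbacktracking_Cons_Cons)
    qed
  qed (rule finite_branch)
  finally show ?thesis .
qed

lemma card_branch_ge:
  assumes "\<And>x. x \<in> V \<Longrightarrow> d \<le> card (E `` {x})" and "(u, v) \<in> E"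
  shows "(d - 1) ^ n \<le> card (branch u v n)"
proof (induction n)
  case 0
  then show ?case using branch_0[OF assms(2)] by simp
next
  case (Suc n)
  have "(d - 1) ^ Suc n \<le> card (branch u v n) * (d - 1)"
    using Suc by simp
  also have "\<dots> \<le> (\<Sum>p\<in>branch u v n. card (E `` {hd p}) - 1)"
  proof -
    have "d - 1 \<le> card (E `` {hd p}) - 1" if p: "p \<in> branch u v n" for p
      using assms(1)[of "hd p"] branch_set[OF p] branch_ne[OF p]
      by (meson diff_le_mono hd_in_set subsetD)
    from sum_bounded_below[OF this, of "branch u v n"] show ?thesis by simp
  qed
  also have "\<dots> \<le> card (branch u v (Suc n))" by (rule card_branch_Suc)
  finally show ?case .
qed

end

section \<open>Consequences of a lower bound on cycle lengths\<close>

locale girth_graph = simple_graph +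
  fixes g :: nat
  assumes girth_le: "cyc E c \<Longrightarrow> g \<le> length c" and g_ge_3: "3 \<le> g"
begin

text \<open>The shortest suffix that repeats a vertex begins with \<open>x # ys @ [x]\<close>, where
  \<open>x # ys\<close> is distinct. Irreflexivity and the absence of backtracking exclude fewer
  than two entries in \<open>ys\<close>, so \<open>x # ys\<close> is a cycle.\<close>

lemma nonbacktracking_not_distinct:
  "nonbacktracking E p \<Longrightarrow> \<not> distinct p \<Longrightarrow> Suc g \<le> length p"
proof (induction p)
  case (Cons x r)
  note nb = nonbacktracking_tl[OF Cons.prems(1)]
  show ?case
  proof (cases "distinct r")
    case True
    then obtain ys zs where r: "r = ys @ x # zs" using Cons.prems by (auto simp: in_set_conv_decomp)
    have nb': "nonbacktracking E (x # ys @ [x])"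
      using Cons.prems(1) nonbacktracking_append1[of E "x # ys @ [x]" zs] unfolding r by simp
    obtain a b cs where ys: "ys = a # b # cs"
    proof (cases ys rule: remdups_adj.cases)
      case 1
      then show ?thesis using nb' E_neq by auto
    next
      case (2 a)
      then show ?thesis using nb' by auto
    qed auto
    have "cyc E (x # ys)" unfolding cyc_def
    proof (intro conjI allI impI)
      fix i assume i: "i < length (x # ys)"
      have "((x # ys @ [x]) ! i, (x # ys @ [x]) ! Suc i) \<in> E"
        by (rule nonbacktracking_successive[OF nb']) (use i in auto)
      moreover have "(x # ys @ [x]) ! i = (x # ys) ! i"
        using i by (metis append_Cons nth_append)
      moreover have "(x # ys @ [x]) ! Suc i = (x # ys) ! (Suc i mod length (x # ys))"
        using i by (cases "Suc i = length (x # ys)") (auto simp: nth_append)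
      ultimately show "((x # ys) ! i, (x # ys) ! (Suc i mod length (x # ys))) \<in> E" by simp
    qed (use True r ys in auto)
    from girth_le[OF this] show ?thesis using r by simp
  qed (use Cons.IH nb in auto)
qed simp

text \<open>Strip the common prefix. Where the walks part, reversing one and joining it to the other
  gives a non-backtracking walk that meets the common last vertex twice; if one walk stops there,
  the other is closed.\<close>

lemma nonbacktracking_same_ends:
  assumes "nonbacktracking E p" "nonbacktracking E q" "p \<noteq> []" "q \<noteq> []"
    and "hd p = hd q" "last p = last q" "p \<noteq> q"
  shows "g + 2 \<le> length p + length q"
  using assms
proof (induction p arbitrary: q)
  case (Cons a p)
  then obtain q' where q: "q = a # q'" by (cases q) auto
  have closed: "g + 2 \<le> Suc (length r + 1)"
    if "nonbacktracking E (a # r)" "r \<noteq> []" "last r = a" for r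
    using nonbacktracking_not_distinct[OF that(1)] that(2,3) last_in_set[of r] by auto
  show ?case
  proof (cases "p = [] \<or> q' = []")
    case True
    then show ?thesis using closed[of p] closed[of q'] Cons.prems q by (auto split: if_splits)
  next
    case False
    show ?thesis
    proof (cases "hd p = hd q'")
      case True
      then have "g + 2 \<le> length p + length q'"
        using Cons.prems q False
        by (intro Cons.IH) (auto dest: nonbacktracking_tl)
      then show ?thesis using q by simp
    next
      case ne: False
      have "nonbacktracking E (rev p @ a # q')"
        by (rule nonbacktracking_join)
          (use Cons.prems q ne False nonbacktracking_rev[OF sym_E, of "a # p"] in \<open>auto simp: last_rev\<close>)
      moreover have "\<not> distinct (rev p @ a # q')"
      proof -
        have "last p \<in> set p \<inter> set q'"
          using Cons.prems(6) q False by (metis IntI last_ConsR last_in_set)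
        then show ?thesis by auto
      qed
      ultimately have "Suc g \<le> length (rev p @ a # q')" by (rule nonbacktracking_not_distinct)
      then show ?thesis using q by simp
    qed
  qed
qed simp

end

section \<open>Graphs attaining the Moore bound\<close>

lemma moore_bound_odd: "moore_bound d (2 * k + 1) = 1 + d * (\<Sum>i<k. (d - 1) ^ i)"
proof -
  have "\<lceil>real (2 * k + 1) / 2\<rceil> = int k + 1" by (rule ceiling_unique) auto
  then show ?thesis
    by (simp add: moore_bound_def Let_def sum_distrib_left atLeast0LessThan)
qed

text \<open>In this form both ends of an edge contribute the branch lengths \<open>0..k\<close>; the
  two terms for length \<open>0\<close> absorb the summand 2.\<close>

lemma moore_bound_even: "moore_bound d (2 * k + 2) = 2 * (\<Sum>i\<le>k. (d - 1) ^ i)"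
proof -
  have "\<lceil>real (2 * k + 2) / 2\<rceil> = int k + 1" by (rule ceiling_unique) auto
  moreover have "(\<Sum>i\<le>k. (d - 1) ^ i) = 1 + (\<Sum>i=1..k. (d - 1) ^ i)"
    by (simp add: atMost_atLeast0 sum.atLeast_Suc_atMost)
  ultimately show ?thesis
    by (simp add: moore_bound_def Let_def sum_distrib_left)
qed

locale moore_graph_rel = girth_graph +
  fixes d :: nat
  assumes d_ge_3: "3 \<le> d" and d_le_degree: "x \<in> V \<Longrightarrow> d \<le> card (E `` {x})"
    and card_V: "card V = moore_bound d g"
begin

lemma branch_append_distinct:
  assumes "p \<in> branch u v n" "n + 2 \<le> g"
  shows "distinct (p @ [v])"
  using nonbacktracking_not_distinct[OF branch_append[OF assms(1)]] assms branch_length[OF assms(1)]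
  by auto

lemma power_le_card_branch: "(u, v) \<in> E \<Longrightarrow> (d - 1) ^ n \<le> card (branch u v n)"
  by (rule card_branch_ge[OF d_le_degree])

lemma branch_nonempty: "(u, v) \<in> E \<Longrightarrow> branch u v n \<noteq> {}"
  using power_le_card_branch[of u v n] d_ge_3 by auto

lemma neighbour_exists: "x \<in> V \<Longrightarrow> \<exists>y. (x, y) \<in> E"
  using d_le_degree[of x] d_ge_3 by (cases "E `` {x} = {}") auto

text \<open>Non-backtracking walks of length \<open>1..k\<close> from \<open>w\<close> end in
  distinct vertices other than \<open>w\<close>. There are at least the degree of \<open>w\<close>
  times \<open>?S\<close> of them, while the Moore bound leaves exactly \<open>d * ?S\<close>
  vertices; equality gives both the degree and the surjectivity.\<close>

lemma moore_odd:
  assumes g: "g = 2 * k + 1" and w: "w \<in> V"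
  shows "card (E `` {w}) = d"
    and "z \<in> V \<Longrightarrow> z \<noteq> w \<Longrightarrow> \<exists>y i p. (y, w) \<in> E \<and> i < k \<and> p \<in> branch y w i \<and> hd p = z"
proof -
  let ?S = "\<Sum>i<k. (d - 1) ^ i"
  let ?I = "SIGMA y:E `` {w}. SIGMA i:{..<k}. branch y w i"
  let ?h = "\<lambda>(y, i, p). hd p"
  have eq: "p = q" if "p \<in> branch y w i" "q \<in> branch y' w i'" "i < k" "i' < k" "hd p = hd q"
    for y y' i i' p q
  proof (rule ccontr)
    assume "p \<noteq> q"
    \<comment> \<open>Appending \<open>w\<close> gives both walks the same last vertex. They have at
      most \<open>k + 1\<close> vertices each, hence at most \<open>g + 1\<close> together.\<close>
    then have "g + 2 \<le> length (p @ [w]) + length (q @ [w])"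
      using that branch_ne by (intro nonbacktracking_same_ends) (auto simp: branch_append)
    then show False using that g by (simp add: branch_length)
  qed
  have inj: "inj_on ?h ?I"
  proof (rule inj_onI)
    fix a b assume "a \<in> ?I" "b \<in> ?I" "?h a = ?h b"
    moreover obtain y i p y' i' q where "a = (y, i, p)" "b = (y', i', q)" by (metis prod_cases3)
    ultimately have *: "p \<in> branch y w i" "q \<in> branch y' w i'" "i < k" "i' < k" "hd p = hd q"
      and ab: "a = (y, i, p)" "b = (y', i', q)" by auto
    have "p = q" by (rule eq[OF *])
    then show "a = b"
      using ab branch_length[OF *(1)] branch_length[OF *(2)]
        branch_last[OF *(1)] branch_last[OF *(2)] by simp
  qed
  have sub: "?h ` ?I \<subseteq> V - {w}"
  proof (rule image_subsetI)
    fix a assume "a \<in> ?I"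
    then obtain y i p where a: "a = (y, i, p)" and i: "i < k" and p: "p \<in> branch y w i" by auto
    have "hd p \<in> set p" using branch_ne[OF p] by simp
    moreover have "distinct (p @ [w])" by (rule branch_append_distinct[OF p]) (use i g in simp)
    ultimately show "?h a \<in> V - {w}" using a branch_set[OF p] by auto
  qed
  have "card (E `` {w}) * ?S \<le> (\<Sum>y\<in>E `` {w}. \<Sum>i<k. card (branch y w i))"
  proof -
    have "?S \<le> (\<Sum>i<k. card (branch y w i))" if "y \<in> E `` {w}" for y
      using that by (intro sum_mono power_le_card_branch) (auto intro: E_sym)
    from sum_bounded_below[OF this, of "E `` {w}"] show ?thesis by simp
  qed
  also have "\<dots> = card ?I" by (simp add: finite_neighbours finite_branch)
  finally have low: "card (E `` {w}) * ?S \<le> card ?I" .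
  have up: "card ?I \<le> card (V - {w})"
    by (rule card_inj_on_le[OF inj sub]) (simp add: finite_V)
  have cV: "card (V - {w}) = d * ?S"
    using card_V w finite_V unfolding g moore_bound_odd by (simp add: card_Diff_singleton)
  have "k \<noteq> 0" using g g_ge_3 by simp
  then have S: "0 < ?S" using d_ge_3 by (intro sum_pos) auto
  then have "card (E `` {w}) \<le> d" using low up cV by (metis mult_le_cancel2 order_trans)
  then show deg: "card (E `` {w}) = d" using d_le_degree[OF w] by simp
  have "card (?h ` ?I) = card (V - {w})" using low up cV deg card_image[OF inj] by simp
  then have "?h ` ?I = V - {w}" using sub finite_V by (intro card_subset_eq) auto
  moreover assume "z \<in> V" "z \<noteq> w"
  ultimately have "z \<in> ?h ` ?I" by blast
  then show "\<exists>y i p. (y, w) \<in> E \<and> i < k \<and> p \<in> branch y w i \<and> hd p = z"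
    by (auto intro: E_sym)
qed

text \<open>Walks of length at most \<open>k\<close> leaving the edge at \<open>w\<close> and at
  \<open>x\<close> have disjoint sets of ends, each of size at least \<open>?S\<close>. As
  \<open>card V\<close> is twice \<open>?S\<close>, both sides attain their bound and together
  exhaust \<open>V\<close>.\<close>

lemma moore_even:
  assumes g: "g = 2 * k + 2" and e: "(w, x) \<in> E"
  shows "card (E `` {w}) = d"
    and "z \<in> V \<Longrightarrow> \<exists>i\<le>k. \<exists>p. (p \<in> branch w x i \<or> p \<in> branch x w i) \<and> hd p = z"
proof -
  let ?S = "\<Sum>i\<le>k. (d - 1) ^ i"
  let ?I = "\<lambda>w x. SIGMA i:{..k}. branch w x i"
  let ?h = "\<lambda>(i, p). hd p"
  have inj: "inj_on ?h (?I w x)" for w x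
  proof (rule inj_onI)
    fix a b assume "a \<in> ?I w x" "b \<in> ?I w x" "?h a = ?h b"
    moreover obtain i p i' q where ab: "a = (i, p)" "b = (i', q)" by fastforce
    ultimately have *: "p \<in> branch w x i" "q \<in> branch w x i'" "i \<le> k" "i' \<le> k" "hd p = hd q"
      by auto
    have "p = q"
    proof (rule ccontr)
      assume "p \<noteq> q"
      then have "g + 2 \<le> length p + length q"
        using * branch_ne
        by (intro nonbacktracking_same_ends) (auto dest: branch_nonbacktracking simp: branch_last)
      then show False using * g by (simp add: branch_length)
    qed
    then show "a = b" using ab branch_length[OF *(1)] branch_length[OF *(2)] by simp
  qed
  have disj: "?h ` ?I w x \<inter> ?h ` ?I x w = {}"
  proof (rule ccontr)
    assume "\<not> ?thesis"
    then obtain i p i' q where *: "p \<in> branch w x i" "q \<in> branch x w i'" "i \<le> k" "i' \<le> k"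
      "hd p = hd q" by auto
    \<comment> \<open>Otherwise \<open>q @ [w]\<close> would end in \<open>w, x, w\<close>, a
      backtrack.\<close>
    have "p @ [x] \<noteq> q"
    proof
      assume "p @ [x] = q"
      moreover have "p = butlast p @ [w]" using branch_ne[OF *(1)] branch_last[OF *(1)]
        by (metis append_butlast_last_id)
      ultimately have "nonbacktracking E (butlast p @ [w, x, w])"
        using branch_append[OF *(2)] by (metis append.assoc append_Cons append_Nil)
      from nonbacktracking_append2[OF this] show False by simp
    qed
    then have "g + 2 \<le> length (p @ [x]) + length q"
      using * branch_ne
      by (intro nonbacktracking_same_ends)
        (auto simp: branch_append branch_last branch_nonbacktracking)
    then show False using * g by (simp add: branch_length)
  qed
  have sub: "?h ` ?I w x \<subseteq> V" for w x
  proof (rule image_subsetI)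
    fix a assume "a \<in> ?I w x"
    then obtain i p where a: "a = (i, p)" and p: "p \<in> branch w x i" by auto
    show "?h a \<in> V" using a branch_ne[OF p] branch_set[OF p] by (simp add: subsetD)
  qed
  have card_I: "card (?h ` ?I w x) = (\<Sum>i\<le>k. card (branch w x i))" for w x
    by (simp add: card_image[OF inj] finite_branch)
  have low: "?S \<le> (\<Sum>i\<le>k. card (branch w x i))" if "(w, x) \<in> E" for w x
    by (intro sum_mono power_le_card_branch that)
  have cV: "card V = 2 * ?S" using card_V unfolding g moore_bound_even .
  have "card (?h ` ?I w x) + card (?h ` ?I x w) = card (?h ` ?I w x \<union> ?h ` ?I x w)"
    by (rule card_Un_disjoint[symmetric]) (use disj finite_subset[OF sub finite_V] in auto)
  also have "\<dots> \<le> card V" by (rule card_mono) (use sub finite_V in auto)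
  finally have up: "card (?h ` ?I w x) + card (?h ` ?I x w) \<le> card V" .
  have eq: "(\<Sum>i\<le>k. card (branch w x i)) = ?S"
    using up low[OF e] low[OF E_sym[OF e]] cV unfolding card_I by linarith
  have "k \<noteq> 0" using g g_ge_3 by simp
  \<comment> \<open>Equal sums of termwise comparable entries agree termwise; the term for length
    \<open>1\<close> counts the neighbours of \<open>w\<close> other than \<open>x\<close>.\<close>
  have "card (branch w x 1) = (d - 1) ^ 1"
    by (rule sum_mono_inv[OF eq[symmetric], symmetric])
      (use power_le_card_branch[OF e] \<open>k \<noteq> 0\<close> in auto)
  then have "card (E `` {w}) - 1 \<le> d - 1"
    using card_branch_Suc[of w x 0] branch_0[OF e] by simp
  then show "card (E `` {w}) = d" using d_le_degree[of w] d_ge_3 E_in_V[OF e] by linarith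
  have "?h ` ?I w x \<union> ?h ` ?I x w = V"
  proof (rule card_subset_eq)
    show "card (?h ` ?I w x \<union> ?h ` ?I x w) = card V"
      using low[OF e] low[OF E_sym[OF e]] cV up card_I
        card_Un_disjoint[OF _ _ disj] finite_subset[OF sub finite_V] by simp
  qed (use sub finite_V in auto)
  moreover assume "z \<in> V"
  ultimately show "\<exists>i\<le>k. \<exists>p. (p \<in> branch w x i \<or> p \<in> branch x w i) \<and> hd p = z"
    by (auto simp: image_iff)
qed

lemma parity_cases:
  obtains k where "g = 2 * k + 1" "1 \<le> k" | k where "g = 2 * k + 2" "1 \<le> k"
proof (cases "odd g")
  case True
  then obtain k where "g = 2 * k + 1" by (rule oddE)
  then show thesis using that(1)[of k] g_ge_3 by simp
next
  case False
  then obtain k where "g = 2 * k" by (auto elim: evenE)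
  then show thesis using that(2)[of "k - 1"] g_ge_3 by simp
qed

lemma degree_eq: "w \<in> V \<Longrightarrow> card (E `` {w}) = d"
  using parity_cases moore_odd(1) moore_even(1) neighbour_exists by metis

lemma branch_relpow:
  assumes "p \<in> branch u v n"
  shows "(hd p, u) \<in> (E \<inter> set p \<times> set p) ^^ n"
  using nonbacktracking_relpow[OF branch_nonbacktracking[OF assms] branch_ne[OF assms]]
  by (simp add: branch_length[OF assms] branch_last[OF assms])

lemma branch_relpow_E: "p \<in> branch u v n \<Longrightarrow> (hd p, u) \<in> E ^^ n"
  using branch_relpow relpow_mono'[of "E \<inter> set p \<times> set p" E] by blast

text \<open>The branches of the Moore count based at \<open>x\<close>, or at any edge containing
  \<open>x\<close>, reach every vertex. For even girth a branch on the far side of that edge costs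
  one more step.\<close>

lemma diameter_le:
  assumes "x \<in> V" "y \<in> V"
  shows "\<exists>n\<le>g div 2. (y, x) \<in> E ^^ n"
proof (cases rule: parity_cases)
  case (1 k)
  show ?thesis
  proof (cases "y = x")
    case False
    then obtain z i p where "(z, x) \<in> E" "i < k" "p \<in> branch z x i" "hd p = y"
      using moore_odd(2)[OF 1(1) assms] by blast
    then show ?thesis using branch_relpow_E[of p z x i] 1
      by (intro exI[of _ "Suc i"]) auto
  qed (auto intro: exI[of _ 0])
next
  case (2 k)
  obtain v where v: "(x, v) \<in> E" using neighbour_exists assms(1) by blast
  obtain i p where *: "i \<le> k" "p \<in> branch x v i \<or> p \<in> branch v x i" "hd p = y"
    using moore_even(2)[OF 2(1) v assms(2)] by blast
  from *(2) show ?thesis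
  proof
    assume "p \<in> branch x v i"
    then show ?thesis using branch_relpow_E[of p x v i] * 2 by (intro exI[of _ i]) auto
  next
    assume "p \<in> branch v x i"
    then show ?thesis using branch_relpow_E[of p v x i] * 2 E_sym[OF v]
      by (intro exI[of _ "Suc i"]) auto
  qed
qed

text \<open>A shortest closed walk through \<open>(w, x)\<close> is found by leaving \<open>w\<close> through \<open>x\<close> to a vertex \<open>z\<close>
  that is just too far from \<open>x\<close> to be reached back through \<open>x\<close>.\<close>

lemma edge_detour:
  assumes e: "(w, x) \<in> E"
  shows "\<exists>n\<le>g - 1. (w, x) \<in> (E - {(w, x), (x, w)}) ^^ n"
proof -
  let ?E = "E - {(w, x), (x, w)}"
  have sym': "sym ?E" using E_sym by (auto intro!: symI)
  have avoid: "(hd p, u) \<in> ?E ^^ n" if "p \<in> branch u v n" "w \<notin> set p \<or> x \<notin> set p" for p u v n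
    using relpow_mono'[OF _ branch_relpow[OF that(1)], of ?E] that(2) by auto
  show ?thesis
  proof (cases rule: parity_cases)
    case (1 k)
    obtain p where p: "p \<in> branch x w k" using branch_nonempty[OF E_sym[OF e]] by blast
    have wp: "w \<notin> set p" using branch_append_distinct[OF p] 1 by simp
    then have "hd p \<noteq> w" "hd p \<in> V" using branch_ne[OF p] branch_set[OF p] by auto
    then obtain y i q where q: "(y, w) \<in> E" "i < k" "q \<in> branch y w i" "hd q = hd p"
      using moore_odd(2)[OF 1(1)] E_in_V[OF e] by metis
    \<comment> \<open>With \<open>y = x\<close>, the walks \<open>p\<close> and \<open>q\<close>
      would share their ends while having \<open>k + 1\<close> and at most \<open>k\<close>
      vertices.\<close>
    have "y \<noteq> x"
    proof
      assume "y = x"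
      moreover have "p \<noteq> q" using q branch_length[OF p] branch_length[OF q(3)] by auto
      ultimately have "g + 2 \<le> length p + length q"
        using p q branch_ne
        by (intro nonbacktracking_same_ends) (auto dest: branch_nonbacktracking simp: branch_last)
      then show False using q p 1 by (simp add: branch_length)
    qed
    moreover have "w \<notin> set q" using branch_append_distinct[OF q(3)] q 1 by simp
    moreover have "x \<noteq> w" using E_neq[OF e] by simp
    moreover have "y \<noteq> w" using E_neq[OF q(1)] .
    ultimately have "(hd q, w) \<in> ?E ^^ Suc i" using avoid[OF q(3)] q(1) by auto
    then have "(w, hd p) \<in> ?E ^^ Suc i" using relpow_sym[OF sym'] q(4) by metis
    then have "(w, x) \<in> ?E ^^ (Suc i + k)" using avoid[OF p] wp by (meson relpow_trans)
    then show ?thesis using q 1 by (intro exI[of _ "Suc i + k"]) auto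
  next
    case (2 k)
    \<comment> \<open>Length \<open>Suc k\<close> lies just beyond the branches of
      \<open>moore_even\<close>, so the branch \<open>q\<close> with the same head must hang at
      \<open>w\<close>. Together they have length at most \<open>k + Suc k = g - 1\<close>.\<close>
    obtain p where p: "p \<in> branch x w (Suc k)" using branch_nonempty[OF E_sym[OF e]] by blast
    have wp: "w \<notin> set p" using branch_append_distinct[OF p] 2 by simp
    have "hd p \<in> V" using branch_ne[OF p] branch_set[OF p] by auto
    then obtain i q where q: "i \<le> k" "q \<in> branch w x i \<or> q \<in> branch x w i" "hd q = hd p"
      using moore_even(2)[OF 2(1) e] by blast
    have "q \<notin> branch x w i"
    proof
      assume q': "q \<in> branch x w i"
      moreover have "p \<noteq> q" using q branch_length[OF p] branch_length[OF q'] by auto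
      ultimately have "g + 2 \<le> length p + length q"
        using p q branch_ne
        by (intro nonbacktracking_same_ends) (auto dest: branch_nonbacktracking simp: branch_last)
      then show False using q p q' 2 by (simp add: branch_length)
    qed
    then have q': "q \<in> branch w x i" using q by blast
    have "x \<notin> set q" using branch_append_distinct[OF q'] q 2 by simp
    then have "(w, hd p) \<in> ?E ^^ i" using relpow_sym[OF sym' avoid[OF q']] q(3) by metis
    then have "(w, x) \<in> ?E ^^ (i + Suc k)" using avoid[OF p] wp by (meson relpow_trans)
    then show ?thesis using q 2 by (intro exI[of _ "i + Suc k"]) auto
  qed
qed

end

section \<open>Distances and cycles as relation powers and lists\<close>

lemma awalk_iff_relpow:
  assumes "u \<in> pverts G"
  shows "(\<exists>p. pre_digraph.awalk (with_proj G) u p v \<and> length p = n) \<longleftrightarrow> (u, v) \<in> parcs G ^^ n"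
proof -
  have "(\<exists>p. set p \<subseteq> parcs G \<and> pcas u p v \<and> length p = n) \<longleftrightarrow> (u, v) \<in> parcs G ^^ n"
  proof (induction n arbitrary: u)
    case 0
    show ?case by auto
  next
    case (Suc n)
    have "(\<exists>p. set p \<subseteq> parcs G \<and> pcas u p v \<and> length p = Suc n) \<longleftrightarrow>
        (\<exists>w. (u, w) \<in> parcs G \<and> (\<exists>p. set p \<subseteq> parcs G \<and> pcas w p v \<and> length p = n))"
      (is "?L \<longleftrightarrow> ?R")
    proof
      assume ?L
      then obtain e p where "insert e (set p) \<subseteq> parcs G" "pcas u (e # p) v" "length p = n"
        by (auto simp: length_Suc_conv)
      then show ?R by (intro exI[of _ "snd e"]) auto
    next
      assume ?R
      then obtain w p where "(u, w) \<in> parcs G" "set p \<subseteq> parcs G" "pcas w p v" "length p = n"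
        by blast
      then show ?L by (intro exI[of _ "(u, w) # p"]) auto
    qed
    then show ?case unfolding Suc.IH by (meson relpow_Suc_I2 relpow_Suc_D2)
  qed
  then show ?thesis using assms by (simp add: pre_digraph.awalk_def cas_with_proj_eq)
qed

lemma graph_dist_le:
  assumes "u \<in> pverts G" "(u, v) \<in> parcs G ^^ n"
  shows "graph_dist G u v \<le> enat n"
proof -
  obtain p where "pre_digraph.awalk (with_proj G) u p v" "length p = n"
    using awalk_iff_relpow[OF assms(1)] assms(2) by blast
  then show ?thesis unfolding graph_dist_def by (intro INF_lower2[of p]) auto
qed

lemma Inf_enat_attained:
  fixes S :: "enat set"
  assumes "Inf S = enat n"
  shows "enat n \<in> S"
proof -
  have "S \<noteq> {}" using assms by (auto simp: Inf_enat_def)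
  then have "(LEAST x. x \<in> S) \<in> S" by (auto intro: LeastI)
  then show ?thesis using assms \<open>S \<noteq> {}\<close> by (simp add: Inf_enat_def)
qed

lemma graph_dist_leD:
  assumes "u \<in> pverts G" "graph_dist G u v \<le> enat n"
  shows "\<exists>m\<le>n. (u, v) \<in> parcs G ^^ m"
proof -
  obtain m where m: "graph_dist G u v = enat m" "m \<le> n"
    using assms(2) by (cases "graph_dist G u v") auto
  then have "enat m \<in> (\<lambda>p. enat (length p)) ` {p. pre_digraph.awalk (with_proj G) u p v}"
    unfolding graph_dist_def by (intro Inf_enat_attained)
  then show ?thesis using awalk_iff_relpow[OF assms(1)] m(2) by auto
qed

lemma pverts_cycle_graph [simp]: "pverts (cycle_graph xs) = set xs"
  by (simp add: cycle_graph_def Let_def)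

lemma parcs_cycle_graph:
  "parcs (cycle_graph xs) = {(xs ! i, xs ! (Suc i mod length xs)) | i. i < length xs} \<union>
     {(xs ! (Suc i mod length xs), xs ! i) | i. i < length xs}"
  by (auto simp: cycle_graph_def Let_def)

lemma cycle_length_cycle_graph: "distinct xs \<Longrightarrow> cycle_length (cycle_graph xs) = length xs"
  by (simp add: cycle_length_def distinct_card)

lemma pair_graphD:
  assumes "pair_graph G"
  shows "simple_graph (pverts G) (parcs G)"
proof -
  interpret pair_graph G by fact
  show ?thesis
    by unfold_locales
      (auto simp: irrefl_def intro!: symI pair_finite_verts dest: in_arcsD1 in_arcsD2 arcs_symmetric no_loops')
qed

lemma pair_graphI:
  assumes "simple_graph (pverts G) (parcs G)"
  shows "pair_graph G"
proof -
  interpret simple_graph "pverts G" "parcs G" by fact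
  show ?thesis
    by unfold_locales
      (use finite_V finite_subset[OF E_subset] sym_E irrefl_E E_subset in
        \<open>auto simp: symmetric_def irrefl_def\<close>)
qed

text \<open>Since the arcs of \<open>G\<close> are symmetric, including the arcs of the list in one
  orientation already makes the cycle a subgraph.\<close>

lemma cycles_eq:
  assumes "pair_graph G"
  shows "cycles G = cycle_graph ` {xs. cyc (parcs G) xs}"
proof -
  interpret G: pair_graph G by fact
  interpret S: simple_graph "pverts G" "parcs G" by (rule pair_graphD) fact
  have wf: "wf_digraph (with_proj (cycle_graph xs))" for xs :: "'a list"
    unfolding wf_digraph_wp_iff
    by unfold_locales (auto simp: parcs_cycle_graph intro!: nth_mem mod_less_divisor)
  have "subgraph (with_proj (cycle_graph xs)) (with_proj G) \<longleftrightarrow>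
      (\<forall>i<length xs. (xs ! i, xs ! (Suc i mod length xs)) \<in> parcs G)" if "xs \<noteq> []" for xs
  proof -
    have "set xs \<subseteq> pverts G" if "\<forall>i<length xs. (xs ! i, xs ! (Suc i mod length xs)) \<in> parcs G"
      using that S.E_in_V by (metis in_set_conv_nth subsetI)
    then show ?thesis
      unfolding subgraph_def compatible_def using wf G.wf_digraph
      by (auto simp: parcs_cycle_graph intro: S.E_sym)
  qed
  then have "distinct xs \<and> 3 \<le> length xs \<and> subgraph (with_proj (cycle_graph xs)) (with_proj G) \<longleftrightarrow>
      cyc (parcs G) xs" for xs
    unfolding cyc_def by (cases "xs = []") auto
  then show ?thesis unfolding cycles_def by auto
qed

lemma girth_eqI:
  assumes "pair_graph G" "\<And>c. cyc (parcs G) c \<Longrightarrow> g \<le> length c"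
    and "cyc (parcs G) c" "length c = g"
  shows "girth G = enat g"
  unfolding girth_def cycles_eq[OF assms(1)]
proof (rule antisym)
  show "(INF C\<in>cycle_graph ` {xs. cyc (parcs G) xs}. enat (cycle_length C)) \<le> enat g"
    by (rule INF_lower2[of "cycle_graph c"])
      (use assms in \<open>auto simp: cyc_def cycle_length_cycle_graph\<close>)
  show "enat g \<le> (INF C\<in>cycle_graph ` {xs. cyc (parcs G) xs}. enat (cycle_length C))"
    by (rule INF_greatest) (use assms(2) in \<open>auto simp: cyc_def cycle_length_cycle_graph\<close>)
qed

lemma girth_eqD:
  assumes "pair_graph G" "girth G = enat g"
  shows "cyc (parcs G) c \<Longrightarrow> g \<le> length c"
    and "\<exists>c. cyc (parcs G) c \<and> length c = g"
proof -
  note eq = assms(2)[unfolded girth_def cycles_eq[OF assms(1)]]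
  show "\<exists>c. cyc (parcs G) c \<and> length c = g"
    using Inf_enat_attained[OF eq] by (auto simp: cyc_def cycle_length_cycle_graph)
  assume c: "cyc (parcs G) c"
  then have "enat g \<le> enat (cycle_length (cycle_graph c))"
    unfolding eq[symmetric] by (intro INF_lower) auto
  then show "g \<le> length c" using c by (auto simp: cyc_def cycle_length_cycle_graph)
qed

lemma out_degree_eq: "out_degree (with_proj G) x = card (parcs G `` {x})"
proof -
  have "out_arcs (with_proj G) x = Pair x ` (parcs G `` {x})" by (auto simp: out_arcs_def)
  then show ?thesis by (simp add: out_degree_def card_image inj_on_def)
qed

section \<open>Rotations of a cycle and walks along it\<close>

lemma cyc_rotate:
  assumes "cyc E xs"
  shows "cyc E (rotate n xs)"
proof -
  have "(rotate n xs ! i, rotate n xs ! (Suc i mod length xs)) \<in> E" if "i < length xs" for i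
  proof -
    have "(Suc i mod length xs + n) mod length xs = Suc ((i + n) mod length xs) mod length xs"
      by (simp add: mod_simps)
    moreover have "0 < length xs" using that by auto
    ultimately show ?thesis using assms that by (simp add: nth_rotate cyc_def add.commute)
  qed
  then show ?thesis using assms by (simp add: cyc_def)
qed

lemma parcs_cycle_graph_rotate_subset:
  "parcs (cycle_graph (rotate n xs)) \<subseteq> parcs (cycle_graph xs)"
proof -
  have "\<exists>k<length xs. rotate n xs ! i = xs ! k \<and>
      rotate n xs ! (Suc i mod length xs) = xs ! (Suc k mod length xs)" if "i < length xs" for i
  proof (intro exI conjI)
    have *: "0 < length xs" using that by auto
    show "(i + n) mod length xs < length xs" using * by simp
    show "rotate n xs ! i = xs ! ((i + n) mod length xs)" using that by (simp add: nth_rotate add.commute)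
    have "(Suc i mod length xs + n) mod length xs = Suc ((i + n) mod length xs) mod length xs"
      by (simp add: mod_simps)
    then show "rotate n xs ! (Suc i mod length xs) = xs ! (Suc ((i + n) mod length xs) mod length xs)"
      using * by (simp add: nth_rotate add.commute)
  qed
  note step = this
  show ?thesis
  proof
    fix e assume "e \<in> parcs (cycle_graph (rotate n xs))"
    then obtain i where i: "i < length xs"
      "e = (rotate n xs ! i, rotate n xs ! (Suc i mod length xs)) \<or>
       e = (rotate n xs ! (Suc i mod length xs), rotate n xs ! i)"
      unfolding parcs_cycle_graph by auto
    obtain k where "k < length xs" "rotate n xs ! i = xs ! k"
      "rotate n xs ! (Suc i mod length xs) = xs ! (Suc k mod length xs)" using step[OF i(1)] by blast
    then show "e \<in> parcs (cycle_graph xs)" using i(2) unfolding parcs_cycle_graph by auto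
  qed
qed

lemma cycle_graph_rotate: "cycle_graph (rotate n xs) = cycle_graph xs"
proof -
  \<comment> \<open>A further rotation by \<open>n * (length xs - 1)\<close> completes
    \<open>n\<close> full turns, so the inclusion just shown also yields its converse.\<close>
  have "rotate (n * (length xs - 1)) (rotate n xs) = xs"
  proof (cases xs)
    case (Cons x r)
    have "n * (length xs - 1) + n = n * length xs" using Cons by simp
    then show ?thesis by (metis rotate_rotate rotate_id mod_mult_self2_is_0)
  qed simp
  then have "parcs (cycle_graph xs) \<subseteq> parcs (cycle_graph (rotate n xs))"
    using parcs_cycle_graph_rotate_subset by metis
  then show ?thesis using parcs_cycle_graph_rotate_subset[of n xs] by (simp add: pair_pre_digraph.equality)
qed

text \<open>An arc moves the index by one or jumps between the two ends of the list. The disjunction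
  says that the cyclic index distance is at most \<open>n\<close>, in a form suited to linear
  arithmetic.\<close>

lemma cycle_graph_relpow:
  assumes "distinct xs" "a < length xs" "(xs ! a, y) \<in> parcs (cycle_graph xs) ^^ n"
  shows "\<exists>b<length xs. y = xs ! b \<and> (\<bar>int a - int b\<bar> \<le> int n \<or>
           int (length xs) \<le> \<bar>int a - int b\<bar> + int n)"
  using assms(3)
proof (induction n arbitrary: y)
  case 0
  then show ?case using assms(2) by auto
next
  case (Suc n)
  then obtain z where z: "(xs ! a, z) \<in> parcs (cycle_graph xs) ^^ n" "(z, y) \<in> parcs (cycle_graph xs)"
    by auto
  from Suc.IH[OF z(1)] obtain b where b: "b < length xs" "z = xs ! b"
    "\<bar>int a - int b\<bar> \<le> int n \<or> int (length xs) \<le> \<bar>int a - int b\<bar> + int n" by blast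
  from z(2) obtain i where i: "i < length xs"
    "z = xs ! i \<and> y = xs ! (Suc i mod length xs) \<or> y = xs ! i \<and> z = xs ! (Suc i mod length xs)"
    unfolding parcs_cycle_graph by auto
  have mod: "Suc i mod length xs = (if Suc i = length xs then 0 else Suc i)" using i(1) by auto
  from i(2) show ?case
  proof (elim disjE conjE)
    assume "z = xs ! i" and y: "y = xs ! (Suc i mod length xs)"
    then have "i = b" using b assms(1) i(1) by (simp add: nth_eq_iff_index_eq)
    then show ?thesis using b y assms(2) unfolding mod
      by (intro exI[of _ "if Suc i = length xs then 0 else Suc i"]) auto
  next
    assume "z = xs ! (Suc i mod length xs)" and y: "y = xs ! i"
    moreover have "Suc i mod length xs < length xs" using i(1) by (auto intro: mod_less_divisor)
    ultimately have "Suc i mod length xs = b" using b(1,2) assms(1) by (simp add: nth_eq_iff_index_eq)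
    then show ?thesis using b y i(1) assms(2) unfolding mod
      by (intro exI[of _ i]) (auto split: if_splits)
  qed
qed

text \<open>By isometry a walk in \<open>G\<close> is matched by a walk on the cycle that is no
  longer. This is how isometry bounds the length of a cycle from above.\<close>

lemma isometric_cycle_relpow:
  assumes iso: "isometric_cycle G (cycle_graph xs)" and V: "set xs \<subseteq> pverts G"
    and xs: "distinct xs" "a < length xs" "b < length xs" and w: "(xs ! a, xs ! b) \<in> parcs G ^^ n"
  shows "\<bar>int a - int b\<bar> \<le> int n \<or> int (length xs) \<le> \<bar>int a - int b\<bar> + int n"
proof -
  have "xs ! a \<in> set xs" "xs ! b \<in> set xs" using xs by auto
  then have "graph_dist (cycle_graph xs) (xs ! a) (xs ! b) = graph_dist G (xs ! a) (xs ! b)"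
    using iso by (simp add: isometric_cycle_def)
  also have "\<dots> \<le> enat n" by (rule graph_dist_le[OF _ w]) (use V xs in auto)
  finally obtain m where m: "m \<le> n" "(xs ! a, xs ! b) \<in> parcs (cycle_graph xs) ^^ m"
    using graph_dist_leD[of "xs ! a" "cycle_graph xs"] xs by auto
  obtain c where c: "c < length xs" "xs ! b = xs ! c" "\<bar>int a - int c\<bar> \<le> int m \<or>
      int (length xs) \<le> \<bar>int a - int c\<bar> + int m"
    using cycle_graph_relpow[OF xs(1,2) m(2)] by blast
  then have "b = c" using xs nth_eq_iff_index_eq by metis
  then show ?thesis using c(3) m(1) by linarith
qed

section \<open>Walks after the deletion of one edge\<close>

lemma relpow_nonbacktracking:
  assumes "(x, y) \<in> R ^^ n"
  shows "\<exists>q. nonbacktracking R q \<and> q \<noteq> [] \<and> hd q = x \<and> last q = y \<and> length q \<le> Suc n"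
  using assms
proof (induction n arbitrary: x)
  case 0
  then show ?case by (intro exI[of _ "[x]"]) auto
next
  case (Suc n)
  then obtain z where z: "(x, z) \<in> R" "(z, y) \<in> R ^^ n" by (meson relpow_Suc_D2)
  from Suc.IH[OF z(2)] obtain q where q: "nonbacktracking R q" "q \<noteq> []" "hd q = z" "last q = y"
    "length q \<le> Suc n" by blast
  then obtain r where r: "q = z # r" by (cases q) auto
  show ?case
  proof (cases "r \<noteq> [] \<and> hd r = x")
    \<comment> \<open>The arc from \<open>x\<close> to \<open>z\<close> and the arc back cancel:
      \<open>r\<close> already starts at \<open>x\<close>.\<close>
    case True
    then show ?thesis using q r by (intro exI[of _ r]) (auto dest: nonbacktracking_tl)
  next
    case False
    then show ?thesis using q r z(1)
      by (intro exI[of _ "x # q"]) (auto simp: nonbacktracking_Cons_Cons)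
  qed
qed

lemma nonbacktracking_mono: "nonbacktracking R p \<Longrightarrow> R \<subseteq> S \<Longrightarrow> nonbacktracking S p"
  by (induction R p rule: nonbacktracking.induct) auto

text \<open>Prefixing \<open>v\<close> closes the detour to a walk from \<open>v\<close> to
  \<open>v\<close>. It does not backtrack at \<open>u\<close>, because the detour cannot use the arc
  back to \<open>v\<close>.\<close>

lemma (in girth_graph) detour_ge:
  assumes e: "(u, v) \<in> E" and w: "(u, v) \<in> (E - {(u, v), (v, u)}) ^^ n"
  shows "g - 1 \<le> n"
proof -
  obtain q where q: "nonbacktracking (E - {(u, v), (v, u)}) q" "q \<noteq> []" "hd q = u" "last q = v"
    "length q \<le> Suc n" using relpow_nonbacktracking[OF w] by blast
  obtain r where r: "q = u # r" using q by (cases q) auto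
  have "r \<noteq> [] \<Longrightarrow> hd r \<noteq> v" using q(1) unfolding r by (cases r) (auto simp: nonbacktracking_Cons_Cons)
  then have "nonbacktracking E (v # q)"
    using nonbacktracking_mono[OF q(1), of E] E_sym[OF e] unfolding r
    by (auto simp: nonbacktracking_Cons_Cons)
  moreover have "\<not> distinct (v # q)" using last_in_set[OF q(2)] q(4) by auto
  ultimately have "Suc g \<le> length (v # q)" by (rule nonbacktracking_not_distinct)
  then show ?thesis using q(5) by simp
qed

text \<open>If the walk uses the edge, keep the piece up to the first use, ending in
  \<open>s\<close>, and the piece after the last use, starting in \<open>t\<close>. The inequality
  is strict because at least one arc is dropped.\<close>

lemma relpow_delete_edge:
  assumes "(x, y) \<in> E ^^ n"
  shows "(\<exists>m\<le>n. (x, y) \<in> (E - {(u, v), (v, u)}) ^^ m) \<or>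
    (\<exists>a b s t. {s, t} \<subseteq> {u, v} \<and> (x, s) \<in> (E - {(u, v), (v, u)}) ^^ a \<and>
       (t, y) \<in> (E - {(u, v), (v, u)}) ^^ b \<and> a + b < n)"
  using assms
proof (induction n arbitrary: x)
  case (Suc n)
  let ?E = "E - {(u, v), (v, u)}"
  obtain z where z: "(x, z) \<in> E" "(z, y) \<in> E ^^ n" using Suc.prems by (meson relpow_Suc_D2)
  from Suc.IH[OF z(2)] show ?case
  proof (elim disjE exE conjE)
    fix m assume avoid: "m \<le> n" "(z, y) \<in> ?E ^^ m"
    show ?thesis
    proof (cases "(x, z) \<in> ?E")
      case True
      then have "(x, y) \<in> ?E ^^ Suc m" using avoid(2) by (rule relpow_Suc_I2)
      then show ?thesis using avoid(1) by blast
    next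
      case False
      then have "{x, z} \<subseteq> {u, v}" using z(1) by auto
      moreover have "(x, x) \<in> ?E ^^ 0" "0 + m < Suc n" using avoid(1) by simp_all
      ultimately show ?thesis using avoid(2) by blast
    qed
  next
    fix a b s t
    assume use: "{s, t} \<subseteq> {u, v}" "(z, s) \<in> ?E ^^ a" "(t, y) \<in> ?E ^^ b" "a + b < n"
    show ?thesis
    proof (cases "(x, z) \<in> ?E")
      case True
      then have "(x, s) \<in> ?E ^^ Suc a" using use(2) by (rule relpow_Suc_I2)
      moreover have "Suc a + b < Suc n" using use(4) by simp
      ultimately show ?thesis using use(1,3) by blast
    next
      case False
      then have "{x, t} \<subseteq> {u, v}" using z(1) use(1) by auto
      moreover have "(x, x) \<in> ?E ^^ 0" "0 + b < Suc n" using use(4) by simp_all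
      ultimately show ?thesis using use(3) by blast
    qed
  qed
qed auto

section \<open>The ring of copies\<close>

lemma graph_dist_mono:
  assumes "x \<in> pverts G" "x \<in> pverts H"
    and "\<And>n. (x, y) \<in> parcs G ^^ n \<Longrightarrow> \<exists>m\<le>n. (x, y) \<in> parcs H ^^ m"
  shows "graph_dist H x y \<le> graph_dist G x y"
proof (cases "graph_dist G x y")
  case (enat n)
  then obtain m where "m \<le> n" "(x, y) \<in> parcs G ^^ m"
    using graph_dist_leD[OF assms(1), of y n] by auto
  then obtain l where "l \<le> n" "(x, y) \<in> parcs H ^^ l" using assms(3) le_trans by blast
  then show ?thesis using graph_dist_le[OF assms(2)] enat
    by (metis enat_ord_simps(1) order_trans)
qed simp

text \<open>Letting \<open>f\<close> contract arcs covers retractions as well as homomorphisms;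
  contracted arcs shorten the walk.\<close>

lemma relpow_image:
  assumes "\<And>a b. (a, b) \<in> R \<Longrightarrow> (f a, f b) \<in> S \<or> f a = f b" "(a, b) \<in> R ^^ n"
  shows "\<exists>m\<le>n. (f a, f b) \<in> S ^^ m"
  using assms(2)
proof (induction n arbitrary: b)
  case (Suc n)
  then obtain c where c: "(a, c) \<in> R ^^ n" "(c, b) \<in> R" by auto
  from Suc.IH[OF c(1)] obtain m where m: "m \<le> n" "(f a, f c) \<in> S ^^ m" by blast
  from assms(1)[OF c(2)] show ?case
  proof
    assume "(f c, f b) \<in> S"
    then have "(f a, f b) \<in> S ^^ Suc m" using m by auto
    then show ?thesis using m by blast
  qed (use m in \<open>auto intro: exI[of _ m]\<close>)
qed auto

section \<open>The graph without the edge: diameter, levels and a spine\<close>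

locale cut_graph = girth_graph +
  fixes u v :: 'a
  assumes uv: "(u, v) \<in> E"
    and detour: "(u, v) \<in> (E - {(u, v), (v, u)}) ^^ (g - 1)"
    and diameter: "x \<in> V \<Longrightarrow> y \<in> V \<Longrightarrow> \<exists>n\<le>g div 2. (x, y) \<in> E ^^ n"
begin

abbreviation "E' \<equiv> E - {(u, v), (v, u)}"

lemma sym_E': "sym E'"
  using E_sym by (auto intro!: symI)

lemma E'_sym: "(x, y) \<in> E' \<Longrightarrow> (y, x) \<in> E'"
  using sym_E' by (rule symD)

text \<open>If a shortest route used the deleted edge, its remaining pieces have at most
  \<open>g div 2 - 1\<close> arcs together, and the detour adds at most
  \<open>g - 1\<close>.\<close>

lemma diameter_E':
  assumes "x \<in> V" "y \<in> V"
  shows "\<exists>n\<le>g div 2 + g - 2. (x, y) \<in> E' ^^ n"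
proof -
  obtain n where n: "n \<le> g div 2" "(x, y) \<in> E ^^ n" using diameter assms by blast
  from relpow_delete_edge[OF n(2), of u v] show ?thesis
  proof (elim disjE exE conjE)
    fix m assume avoid: "m \<le> n" "(x, y) \<in> E' ^^ m"
    moreover have "m \<le> g div 2 + g - 2" using avoid(1) n(1) g_ge_3 by linarith
    ultimately show ?thesis by blast
  next
    fix a b s t
    assume use: "{s, t} \<subseteq> {u, v}" "(x, s) \<in> E' ^^ a" "(t, y) \<in> E' ^^ b" "a + b < n"
    obtain c where c: "c \<le> g - 1" "(s, t) \<in> E' ^^ c"
    proof (cases "s = t")
      case True
      then show ?thesis using that[of 0] by simp
    next
      case False
      then have "s = u \<and> t = v \<or> s = v \<and> t = u" using use(1) by auto
      then show ?thesis using that[OF le_refl] detour relpow_sym[OF sym_E' detour] by metis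
    qed
    have "(x, y) \<in> E' ^^ (a + (c + b))" using use(2,3) c(2) by (meson relpow_trans)
    moreover have "a + (c + b) \<le> g div 2 + g - 2" using use(4) c(1) n(1) g_ge_3 by linarith
    ultimately show ?thesis by blast
  qed
qed

text \<open>Distance from \<open>u\<close> without the edge, cut off at \<open>g - 1\<close>, the
  distance of \<open>v\<close>. With the cut-off, each copy fits one block of \<open>g\<close>
  values in a coordinate around a ring of length \<open>j * g\<close>.\<close>

definition level :: "'a \<Rightarrow> nat" where
  "level x = min (LEAST n. (u, x) \<in> E' ^^ n) (g - 1)"

lemma level_le: "level x \<le> g - 1"
  by (simp add: level_def)

lemma level_less: "level x < g"
  using level_le[of x] g_ge_3 by simp

lemma level_u: "level u = 0"
proof -
  have "(LEAST n. (u, u) \<in> E' ^^ n) \<le> 0" by (rule Least_le) simp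
  then show ?thesis by (simp add: level_def)
qed

lemma level_v: "level v = g - 1"
proof -
  have "(u, v) \<in> E' ^^ (LEAST n. (u, v) \<in> E' ^^ n)" using detour by (rule LeastI)
  from detour_ge[OF uv this] show ?thesis by (simp add: level_def)
qed

lemma level_step:
  assumes "(x, y) \<in> E'"
  shows "level y \<le> Suc (level x)"
proof -
  let ?n = "LEAST n. (u, x) \<in> E' ^^ n"
  have "\<exists>n. (u, x) \<in> E' ^^ n" using diameter_E'[of u x] E_in_V assms uv by blast
  then have "(u, x) \<in> E' ^^ ?n" by (rule LeastI_ex)
  then have "(u, y) \<in> E' ^^ Suc ?n" using assms by auto
  then have "(LEAST n. (u, y) \<in> E' ^^ n) \<le> Suc ?n" by (rule Least_le)
  then show ?thesis by (simp add: level_def min_def)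
qed

definition spine :: "nat \<Rightarrow> 'a" where
  "spine = (SOME p. p 0 = u \<and> p (g - 1) = v \<and> (\<forall>i<g - 1. (p i, p (Suc i)) \<in> E'))"

lemma spine: "spine 0 = u" "spine (g - 1) = v" "i < g - 1 \<Longrightarrow> (spine i, spine (Suc i)) \<in> E'"
proof -
  have "\<exists>p. p 0 = u \<and> p (g - 1) = v \<and> (\<forall>i<g - 1. (p i, p (Suc i)) \<in> E')"
    using detour unfolding relpow_fun_conv .
  from someI_ex[OF this, folded spine_def]
  show "spine 0 = u" "spine (g - 1) = v" "i < g - 1 \<Longrightarrow> (spine i, spine (Suc i)) \<in> E'" by auto
qed

text \<open>\<open>level\<close> rises by at most one per arc, yet climbs from \<open>0\<close> to
  \<open>g - 1\<close> along \<open>g - 1\<close> arcs. Counting from the start gives the upper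
  bound, counting from the end the lower one.\<close>

lemma level_spine:
  assumes "i \<le> g - 1"
  shows "level (spine i) = i"
proof (rule antisym)
  show "level (spine i) \<le> i" using assms
  proof (induction i)
    case (Suc i)
    then show ?case using level_step[OF spine(3)[of i]] by auto
  qed (simp add: spine(1) level_u)
  have "g - 1 \<le> level (spine i) + (g - 1 - i)" using assms
  proof (induction rule: inc_induct)
    case (step n)
    then show ?case using level_step[OF spine(3)[of n]] by linarith
  qed (use spine(2) level_v in simp)
  then show "i \<le> level (spine i)" using assms by simp
qed

lemma spine_in_V: "i \<le> g - 1 \<Longrightarrow> spine i \<in> V"
  using spine(3)[of i] spine(2) E_in_V uv by (cases "i < g - 1") auto

end

section \<open>Vertices, edges and degrees of the ring\<close>

locale ring_of_copies = cut_graph +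
  fixes j :: nat and cop :: "'b \<Rightarrow> nat" and ver :: "'b \<Rightarrow> 'a" and W :: "'b set"
  assumes j_ge_3: "3 \<le> j"
    and bij: "bij_betw (\<lambda>a. (cop a, ver a)) W ({..<j} \<times> V)"
begin

text \<open>The vertex type of the ring is left open and coded by pairs of a copy and an original
  vertex, so that natural numbers can serve in the end; \<open>vtx\<close> turns a pair back into a
  vertex.\<close>

definition vtx :: "nat \<Rightarrow> 'a \<Rightarrow> 'b" where
  "vtx i x = inv_into W (\<lambda>a. (cop a, ver a)) (i, x)"

definition link :: "'b \<Rightarrow> 'b \<Rightarrow> bool" where
  "link a b \<longleftrightarrow> ver a = v \<and> ver b = u \<and> cop b = Suc (cop a) mod j"

definition F :: "'b rel" where
  "F = {(a, b). a \<in> W \<and> b \<in> W \<and> (cop a = cop b \<and> (ver a, ver b) \<in> E' \<or> link a b \<or> link b a)}"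

lemma vtx:
  assumes "i < j" "x \<in> V"
  shows "vtx i x \<in> W" "cop (vtx i x) = i" "ver (vtx i x) = x"
proof -
  have *: "(i, x) \<in> (\<lambda>a. (cop a, ver a)) ` W"
    using bij assms by (auto simp: bij_betw_def)
  show "vtx i x \<in> W" unfolding vtx_def using * by (rule inv_into_into)
  show "cop (vtx i x) = i" "ver (vtx i x) = x"
    using f_inv_into_f[OF *] by (auto simp: vtx_def)
qed

lemma W_cop: "a \<in> W \<Longrightarrow> cop a < j" and W_ver: "a \<in> W \<Longrightarrow> ver a \<in> V"
  using bij_betw_apply[OF bij] by auto

lemma W_eqI: "a \<in> W \<Longrightarrow> b \<in> W \<Longrightarrow> cop a = cop b \<Longrightarrow> ver a = ver b \<Longrightarrow> a = b"
  using bij_betw_imp_inj_on[OF bij] by (auto dest: inj_onD)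

lemma finite_W: "finite W"
  using bij_betw_finite[OF bij] finite_V by simp

lemma card_W: "card W = j * card V"
  using bij_betw_same_card[OF bij] by (simp add: card_cartesian_product)

lemma u_neq_v: "u \<noteq> v"
  using E_neq uv by auto

lemma F_in_W: "(a, b) \<in> F \<Longrightarrow> a \<in> W \<and> b \<in> W"
  by (auto simp: F_def)

lemma F_sym: "(a, b) \<in> F \<Longrightarrow> (b, a) \<in> F"
  unfolding F_def using E'_sym by auto

lemma F_cases:
  assumes "(a, b) \<in> F"
  obtains (inner) "cop a = cop b" "(ver a, ver b) \<in> E'" | (forward) "link a b" | (backward) "link b a"
  using assms by (auto simp: F_def)

lemma F_ver: "(a, b) \<in> F \<Longrightarrow> (ver a, ver b) \<in> E"
  using uv E_sym[OF uv] by (auto simp: F_def link_def)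

lemma F_inner: "(a, b) \<in> F \<Longrightarrow> (ver a, ver b) \<in> E' \<Longrightarrow> cop a = cop b"
  by (auto simp: F_def link_def)

lemma F_forward: "(a, b) \<in> F \<Longrightarrow> ver a = v \<Longrightarrow> ver b = u \<Longrightarrow> link a b"
  using u_neq_v by (auto simp: F_def link_def)

lemma F_backward: "(a, b) \<in> F \<Longrightarrow> ver a = u \<Longrightarrow> ver b = v \<Longrightarrow> link b a"
  using F_forward F_sym by blast

lemma simple_graph_F: "simple_graph W F"
proof
  show "sym F" using F_sym by (rule symI)
  show "irrefl F" using E_neq u_neq_v by (auto simp: irrefl_def F_def link_def)
qed (use finite_W in \<open>auto simp: F_def\<close>)

lemma Suc_mod_inj: "a < j \<Longrightarrow> b < j \<Longrightarrow> Suc a mod j = Suc b mod j \<Longrightarrow> a = b"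
  by (auto simp: mod_Suc split: if_splits)

text \<open>\<open>ver\<close> maps neighbourhoods bijectively. The links restore what the cut
  removed: \<open>v\<close> gets the \<open>u\<close> of the next copy, and \<open>u\<close> gets
  the \<open>v\<close> of the previous one.\<close>

lemma degree_F:
  assumes a: "a \<in> W"
  shows "card (F `` {a}) = card (E `` {ver a})"
proof (rule bij_betw_same_card[of ver], rule bij_betw_imageI)
  show "inj_on ver (F `` {a})"
  proof (rule inj_onI)
    fix b c assume "b \<in> F `` {a}" "c \<in> F `` {a}" and eq: "ver b = ver c"
    then have b: "(a, b) \<in> F" and c: "(a, c) \<in> F" by auto
    consider "(ver a, ver b) \<in> E'" | "ver a = v" "ver b = u" | "ver a = u" "ver b = v"
      using F_ver[OF b] by blast
    then have "cop b = cop c"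
    proof cases
      case 1
      then show ?thesis using F_inner[OF b] F_inner[OF c] eq by simp
    next
      case 2
      then show ?thesis using F_forward[OF b] F_forward[OF c] eq by (simp add: link_def)
    next
      case 3
      then have "Suc (cop b) mod j = Suc (cop c) mod j"
        using F_backward[OF b] F_backward[OF c] eq by (simp add: link_def)
      then show ?thesis using Suc_mod_inj W_cop F_in_W[OF b] F_in_W[OF c] by blast
    qed
    then show "b = c" using W_eqI F_in_W b c eq by blast
  qed
  show "ver ` (F `` {a}) = E `` {ver a}"
  proof
    show "ver ` (F `` {a}) \<subseteq> E `` {ver a}"
      using F_ver by auto
    show "E `` {ver a} \<subseteq> ver ` (F `` {a})"
    proof
      fix y assume "y \<in> E `` {ver a}"
      then have y: "(ver a, y) \<in> E" and yV: "y \<in> V" using E_in_V by auto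
      have ca: "cop a < j" by (rule W_cop[OF a])
      have "\<exists>b. (a, b) \<in> F \<and> ver b = y"
      proof -
        consider "(ver a, y) \<in> E'" | "ver a = v" "y = u" | "ver a = u" "y = v" using y by blast
        then show ?thesis
        proof cases
          case 1
          then have "(a, vtx (cop a) y) \<in> F" using a vtx[OF ca yV] by (simp add: F_def)
          then show ?thesis using vtx(3)[OF ca yV] by blast
        next
          case 2
          have c: "Suc (cop a) mod j < j" using j_ge_3 by simp
          have "(a, vtx (Suc (cop a) mod j) y) \<in> F"
            using a vtx[OF c yV] 2 by (simp add: F_def link_def)
          then show ?thesis using vtx(3)[OF c yV] by blast
        next
          case 3
          obtain c where c: "c < j" "Suc c mod j = cop a"
          proof (cases "cop a")
            case 0
            then show ?thesis using that[of "j - 1"] j_ge_3 by simp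
          next
            case (Suc m)
            then show ?thesis using that[of m] ca by simp
          qed
          have "(a, vtx c y) \<in> F" using a vtx[OF c(1) yV] c(2) 3 by (simp add: F_def link_def)
          then show ?thesis using vtx(3)[OF c(1) yV] by blast
        qed
      qed
      then show "y \<in> ver ` (F `` {a})" by auto
    qed
  qed
qed

lemma relpow_lift:
  assumes "a \<in> W" "(ver a, y) \<in> E' ^^ n"
  shows "(a, vtx (cop a) y) \<in> F ^^ n"
  using assms(2)
proof (induction n arbitrary: y)
  case 0
  then have "vtx (cop a) y = a" using vtx[of "cop a" y] W_cop W_ver assms(1) by (intro W_eqI) auto
  then show ?case by simp
next
  case (Suc n)
  then obtain z where z: "(ver a, z) \<in> E' ^^ n" "(z, y) \<in> E'" by auto
  then have "(vtx (cop a) z, vtx (cop a) y) \<in> F"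
    using vtx[of "cop a" z] vtx[of "cop a" y] W_cop[OF assms(1)] E_in_V[of z y] by (auto simp: F_def)
  then show ?case using Suc.IH[OF z(1)] by auto
qed

lemma relpow_lift':
  assumes "a \<in> W" "b \<in> W" "cop a = cop b" "(ver a, ver b) \<in> E' ^^ n"
  shows "(a, b) \<in> F ^^ n"
proof -
  have "vtx (cop a) (ver b) = b"
    using assms vtx[of "cop a" "ver b"] W_cop W_ver by (intro W_eqI) auto
  then show ?thesis using relpow_lift[OF assms(1,4)] by simp
qed

end

section \<open>Cycles through a link\<close>

text \<open>A cycle through a link, cut open there: indices \<open>0\<close> and \<open>L - 1\<close> are the two ends of that
  link, and copies are counted from the copy containing \<open>x 0\<close>.\<close>

locale ring_path = ring_of_copies +
  fixes x :: "nat \<Rightarrow> 'b" and L :: nat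
  assumes L_ge_3: "3 \<le> L" and inj_x: "inj_on x {..<L}"
    and x_step: "Suc i < L \<Longrightarrow> (x i, x (Suc i)) \<in> F"
    and x_closing: "link (x (L - 1)) (x 0)"
begin

definition pos :: "nat \<Rightarrow> nat" where
  "pos i = (cop (x i) + (j - cop (x 0))) mod j"

text \<open>Unrolls the ring into a line: since \<open>level v = g - 1\<close> and
  \<open>level u = 0\<close>, crossing a link forward raises the value by exactly one.\<close>

definition height :: "nat \<Rightarrow> nat" where
  "height i = pos i * g + level (ver (x i))"

lemma x_in_W: "i < L \<Longrightarrow> x i \<in> W"
  using x_step[of i] x_step[of "i - 1"] F_in_W L_ge_3 by (cases i; cases "Suc i < L") auto

lemma pos_less: "pos i < j"
  using j_ge_3 by (simp add: pos_def)

lemma cop_x0: "cop (x 0) < j"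
  using W_cop x_in_W L_ge_3 by auto

lemma pos_0: "pos 0 = 0"
  using cop_x0 by (simp add: pos_def)

lemma ver_0: "ver (x 0) = u" and ver_last: "ver (x (L - 1)) = v"
  using x_closing by (auto simp: link_def)

lemma pos_link: "link (x i) (x k) \<Longrightarrow> pos k = Suc (pos i) mod j"
  by (simp add: pos_def link_def mod_simps)

lemma pos_eqD:
  assumes "i < L" "k < L" "pos i = pos k"
  shows "cop (x i) = cop (x k)"
proof -
  have "(pos i + cop (x 0)) mod j = cop (x i)" if "i < L" for i
  proof -
    have "(pos i + cop (x 0)) mod j = (cop (x i) + (j - cop (x 0)) + cop (x 0)) mod j"
      by (simp add: pos_def mod_simps)
    also have "cop (x i) + (j - cop (x 0)) + cop (x 0) = cop (x i) + j" using cop_x0 by simp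
    finally show ?thesis using W_cop x_in_W that by simp
  qed
  then show ?thesis using assms by metis
qed

lemma index_eqI: "i < L \<Longrightarrow> k < L \<Longrightarrow> pos i = pos k \<Longrightarrow> ver (x i) = ver (x k) \<Longrightarrow> i = k"
  using pos_eqD W_eqI x_in_W inj_x by (metis inj_onD lessThan_iff)

lemma pos_last: "pos (L - 1) = j - 1"
proof -
  have "Suc (pos (L - 1)) mod j = 0" using pos_link[OF x_closing] pos_0 by simp
  then show ?thesis using pos_less[of "L - 1"] by (auto simp: mod_Suc split: if_splits)
qed

text \<open>A single link joins the last copy to the first, and it is already the closing arc; hence
  \<open>pos\<close> never wraps around along the path.\<close>

lemma step_cases:
  assumes i: "Suc i < L"
  obtains (inner) "pos (Suc i) = pos i" "(ver (x i), ver (x (Suc i))) \<in> E'"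
  | (forward) "ver (x i) = v" "ver (x (Suc i)) = u" "pos (Suc i) = Suc (pos i)"
  | (backward) "ver (x i) = u" "ver (x (Suc i)) = v" "pos i = Suc (pos (Suc i))"
  using x_step[OF i]
proof (cases rule: F_cases)
  case inner
  then show ?thesis using that(1) by (simp add: pos_def)
next
  case forward
  have ver: "ver (x i) = v" "ver (x (Suc i)) = u" using forward by (auto simp: link_def)
  have "Suc (pos i) \<noteq> j"
  proof
    assume "Suc (pos i) = j"
    then have "pos (Suc i) = pos 0" unfolding pos_link[OF forward] pos_0 by simp
    then have "Suc i = 0" by (rule index_eqI[OF i, rotated]) (use ver(2) ver_0 i in simp_all)
    then show False by simp
  qed
  then have "pos (Suc i) = Suc (pos i)" using pos_link[OF forward] pos_less[of i] by simp
  then show ?thesis using ver by (intro that(2)) auto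
next
  case backward
  have ver: "ver (x (Suc i)) = v" "ver (x i) = u" using backward by (auto simp: link_def)
  \<comment> \<open>Wrapping backwards would make this step run from \<open>x 0\<close> to
    \<open>x (L - 1)\<close>, which leaves room for only two vertices.\<close>
  have "Suc (pos (Suc i)) \<noteq> j"
  proof
    assume *: "Suc (pos (Suc i)) = j"
    then have "pos i = pos 0" unfolding pos_link[OF backward] pos_0 by simp
    then have "i = 0" by (rule index_eqI[rotated 2]) (use ver(2) ver_0 i in simp_all)
    moreover have "pos (Suc i) = pos (L - 1)" using * pos_last by simp
    then have "Suc i = L - 1" by (rule index_eqI[OF i, rotated]) (use ver(1) ver_last i in simp_all)
    ultimately show False using L_ge_3 by simp
  qed
  then have "pos i = Suc (pos (Suc i))"
    using pos_link[OF backward] pos_less[of "Suc i"] by simp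
  then show ?thesis using ver by (intro that(3)) auto
qed

lemma height_step:
  assumes "Suc i < L"
  shows "height (Suc i) \<le> Suc (height i)" "height i \<le> Suc (height (Suc i))"
proof -
  have "height (Suc i) \<le> Suc (height i) \<and> height i \<le> Suc (height (Suc i))"
    using assms
  proof (cases rule: step_cases)
    case inner
    then show ?thesis using level_step[OF inner(2)] level_step[OF E'_sym[OF inner(2)]]
      by (simp add: height_def)
  qed (use g_ge_3 in \<open>auto simp: height_def level_u level_v\<close>)
  then show "height (Suc i) \<le> Suc (height i)" "height i \<le> Suc (height (Suc i))" by auto
qed

lemma height_lipschitz:
  assumes "i \<le> k" "k < L"
  shows "height k \<le> height i + (k - i)"
  using assms
proof (induction rule: dec_induct)
  case (step n)
  then show ?case using height_step(1)[of n] by simp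
qed simp

lemma height_0: "height 0 = 0"
  by (simp add: height_def pos_0 ver_0 level_u)

lemma height_last: "Suc (height (L - 1)) = j * g"
proof -
  have "(j - 1) * g + g = j * g" using j_ge_3 by (cases j) auto
  moreover have "height (L - 1) = (j - 1) * g + (g - 1)"
    unfolding height_def pos_last ver_last level_v ..
  ultimately show ?thesis using g_ge_3 by simp
qed

text \<open>The height climbs from \<open>0\<close> to \<open>j * g - 1\<close> in
  \<open>L - 1\<close> steps, each raising it by at most one.\<close>

lemma length_ge: "j * g \<le> L"
  using height_lipschitz[of 0 "L - 1"] height_0 height_last L_ge_3 by simp

text \<open>Consider the first index whose copy lies beyond \<open>m\<close>. As \<open>pos\<close>
  changes only across a link, and then by one, the step before it is a forward link out of copy
  \<open>m\<close>.\<close>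

lemma crossing:
  assumes "m < j - 1"
  shows "\<exists>r. Suc r < L \<and> pos r = m \<and> ver (x r) = v \<and> pos (Suc r) = Suc m \<and> ver (x (Suc r)) = u"
proof -
  let ?k = "LEAST k. m < pos k"
  have ex: "m < pos (L - 1)" using assms pos_last by simp
  have k: "m < pos ?k" using ex by (rule LeastI)
  have "?k \<le> L - 1" using ex by (rule Least_le)
  then have kL: "?k < L" using L_ge_3 by simp
  obtain r where r: "?k = Suc r" using k pos_0 by (cases ?k) auto
  have "pos r \<le> m" using not_less_Least[of r "\<lambda>k. m < pos k"] r by simp
  moreover have "m < pos (Suc r)" using k r by simp
  moreover have rL: "Suc r < L" using kL r by simp
  ultimately show ?thesis by - (rule step_cases[OF rL], auto)
qed

text \<open>Inside a copy \<open>u\<close> and \<open>v\<close> are joined by \<open>g - 1\<close>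
  arcs, so isometry keeps entry and exit within cyclic index distance \<open>g - 1\<close>. By
  induction copy \<open>m\<close> is entered at index \<open>m * g\<close>, and the last copy ends
  at index \<open>L - 1\<close>.\<close>

lemma length_le:
  assumes iso: "\<And>a b n. a < L \<Longrightarrow> b < L \<Longrightarrow> (x a, x b) \<in> F ^^ n \<Longrightarrow>
      \<bar>int a - int b\<bar> \<le> int n \<or> int L \<le> \<bar>int a - int b\<bar> + int n"
  shows "L \<le> j * g"
proof -
  have close: "\<bar>int a - int r\<bar> \<le> int (g - 1) \<or> int L \<le> \<bar>int a - int r\<bar> + int (g - 1)"
    if "a < L" "r < L" "pos a = pos r" "ver (x a) = u" "ver (x r) = v" for a r
    using that detour pos_eqD[OF that(1-3)] by (intro iso relpow_lift') (auto simp: x_in_W)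
  have j3: "3 * g \<le> j * g" using j_ge_3 by simp
  have entry: "\<exists>a<L. pos a = m \<and> ver (x a) = u \<and> a = m * g" if "m < j" for m
    using that
  proof (induction m)
    case 0
    then show ?case using pos_0 ver_0 L_ge_3 by (intro exI[of _ 0]) auto
  next
    case (Suc m)
    then obtain a where a: "a < L" "pos a = m" "ver (x a) = u" "a = m * g" by auto
    obtain r where r: "Suc r < L" "pos r = m" "ver (x r) = v" "pos (Suc r) = Suc m"
      "ver (x (Suc r)) = u" using crossing[of m] Suc.prems less_diff_conv[of m j 1] by auto
    have hr: "height r = m * g + (g - 1)" using r by (simp add: height_def level_v)
    have "m * g + (g - 1) \<le> r" using height_lipschitz[of 0 r] r hr height_0 by simp
    moreover have "height (L - 1) \<le> height r + (L - 1 - r)"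
      by (rule height_lipschitz) (use r(1) in auto)
    moreover have "\<bar>int a - int r\<bar> \<le> int (g - 1) \<or> int L \<le> \<bar>int a - int r\<bar> + int (g - 1)"
      using close[of a r] a r by simp
    \<comment> \<open>Height bounds \<open>r\<close> from below and closeness from above. Closeness
      the other way round the cycle would force \<open>j * g \<le> 2 * g - 2\<close>.\<close>
    ultimately have "Suc r = m * g + g" using a(4) r(1) j3 g_ge_3 hr height_last by linarith
    then show ?case using r by (intro exI[of _ "Suc r"]) auto
  qed
  obtain a where a: "a < L" "pos a = j - 1" "ver (x a) = u" "a = (j - 1) * g"
    using entry[of "j - 1"] j_ge_3 by auto
  have "\<bar>int a - int (L - 1)\<bar> \<le> int (g - 1) \<or> int L \<le> \<bar>int a - int (L - 1)\<bar> + int (g - 1)"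
    using close[of a "L - 1"] a pos_last ver_last L_ge_3 by simp
  moreover have "(j - 1) * g + g = j * g" using j_ge_3 by (cases j) auto
  ultimately show ?thesis using a(1,4) j3 g_ge_3 by linarith
qed

end

section \<open>Girth and isometric cycles of the ring\<close>

context ring_of_copies
begin

lemma cyc_F_subset: "cyc F xs \<Longrightarrow> set xs \<subseteq> W"
  using F_in_W unfolding cyc_def by (metis in_set_conv_nth subsetI)

text \<open>Without links the cycle stays in one copy and projects injectively. Otherwise it is
  rotated until a link is its closing arc, and listed in reverse if that link is traversed
  backwards.\<close>

lemma cyc_F_cases:
  assumes xs: "cyc F xs"
  obtains (inner) "cyc E' (map ver xs)" "\<And>y. y \<in> set xs \<Longrightarrow> cop y = cop (xs ! 0)"
  | (through_link) n x where "ring_path V E g u v j cop ver W x (length xs)"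
      "(\<forall>i<length xs. x i = rotate n xs ! i) \<or> (\<forall>i<length xs. x i = rotate n xs ! (length xs - 1 - i))"
proof (cases "\<forall>i<length xs. cop (xs ! i) = cop (xs ! (Suc i mod length xs)) \<and>
    (ver (xs ! i), ver (xs ! (Suc i mod length xs))) \<in> E'")
  case True
  have cop: "cop (xs ! i) = cop (xs ! 0)" if "i < length xs" for i
    using that
  proof (induction i)
    case (Suc i)
    then show ?case using True[rule_format, of i] by simp
  qed simp
  then have cop': "cop y = cop (xs ! 0)" if "y \<in> set xs" for y
    using that by (auto simp: in_set_conv_nth)
  have "inj_on ver (set xs)"
    using cyc_F_subset[OF xs] cop' by (auto intro!: inj_onI W_eqI)
  moreover have "(map ver xs ! i, map ver xs ! (Suc i mod length xs)) \<in> E'" if "i < length xs" for i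
  proof -
    have "Suc i mod length xs < length xs" using that by (intro mod_less_divisor) linarith
    then show ?thesis using True that by simp
  qed
  ultimately have "cyc E' (map ver xs)" using xs by (simp add: cyc_def distinct_map)
  then show thesis using cop' by (rule inner)
next
  case False
  let ?L = "length xs"
  have L: "3 \<le> ?L" using xs by (simp add: cyc_def)
  obtain i where i: "i < ?L"
    "\<not> (cop (xs ! i) = cop (xs ! (Suc i mod ?L)) \<and> (ver (xs ! i), ver (xs ! (Suc i mod ?L))) \<in> E')"
    using False by blast
  \<comment> \<open>Rotating by \<open>Suc i\<close> turns the arc at index \<open>i\<close> into
    the closing arc.\<close>
  define ys where "ys = rotate (Suc i) xs"
  have ys: "cyc F ys" "length ys = ?L" unfolding ys_def using cyc_rotate[OF xs] by (blast intro: length_rotate)+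
  have inj: "inj_on (\<lambda>i. ys ! i) {..<?L}" using ys by (auto simp: cyc_def inj_on_def nth_eq_iff_index_eq)
  have step: "(ys ! k, ys ! Suc k) \<in> F" if "Suc k < ?L" for k
    using ys that by (auto simp: cyc_def dest: spec[of _ k])
  have "ys ! 0 = xs ! (Suc i mod ?L)" using L unfolding ys_def by (subst nth_rotate) auto
  moreover have "ys ! (?L - 1) = xs ! i"
  proof -
    have "Suc i + (?L - 1) = i + ?L" using L by simp
    then have "(Suc i + (?L - 1)) mod ?L = i" using i(1) by simp
    then show ?thesis using L unfolding ys_def by (subst nth_rotate) auto
  qed
  moreover have "(xs ! i, xs ! (Suc i mod ?L)) \<in> F" using xs i(1) by (simp add: cyc_def)
  then have "link (xs ! i) (xs ! (Suc i mod ?L)) \<or> link (xs ! (Suc i mod ?L)) (xs ! i)"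
    using i(2) by (cases rule: F_cases) auto
  ultimately have "link (ys ! (?L - 1)) (ys ! 0) \<or> link (ys ! 0) (ys ! (?L - 1))" by simp
  then show thesis
  proof
    assume "link (ys ! (?L - 1)) (ys ! 0)"
    then have "ring_path V E g u v j cop ver W (\<lambda>i. ys ! i) ?L"
      using L inj step by unfold_locales auto
    then show thesis by (rule through_link[of _ "Suc i"]) (simp add: ys_def)
  next
    assume *: "link (ys ! 0) (ys ! (?L - 1))"
    have "ring_path V E g u v j cop ver W (\<lambda>i. ys ! (?L - 1 - i)) ?L"
    proof unfold_locales
      show "inj_on (\<lambda>i. ys ! (?L - 1 - i)) {..<?L}"
        using ys by (auto simp: cyc_def inj_on_def nth_eq_iff_index_eq)
      fix k assume k: "Suc k < ?L"
      then have "Suc (?L - 1 - Suc k) = ?L - 1 - k" by simp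
      then show "(ys ! (?L - 1 - k), ys ! (?L - 1 - Suc k)) \<in> F"
        using step[of "?L - 1 - Suc k"] k F_sym by simp
    qed (use L * in auto)
    then show thesis by (rule through_link[of _ "Suc i"]) (simp add: ys_def)
  qed
qed

lemma girth_F:
  assumes "cyc F xs"
  shows "g \<le> length xs"
  using assms
proof (cases rule: cyc_F_cases)
  case inner
  have "cyc E (map ver xs)" using inner(1) by (auto simp: cyc_def)
  then show ?thesis using girth_le by fastforce
next
  case (through_link n x)
  have "g \<le> j * g" using j_ge_3 by (cases j) auto
  then show ?thesis using ring_path.length_ge[OF through_link(1)] by (rule le_trans)
qed

lemma isometric_cycle_length_le:
  assumes G: "pverts G = W" "parcs G = F" and xs: "cyc F xs"
    and iso: "isometric_cycle G (cycle_graph xs)"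
  shows "length xs \<le> j * g"
  using xs
proof (cases rule: cyc_F_cases)
  case inner
  \<comment> \<open>Opposite vertices are \<open>?k\<close> apart on the cycle, so \<open>?k\<close>
    is at most \<open>g div 2 + g - 2\<close> and \<open>length xs \<le> 3 * g - 3\<close>.\<close>
  let ?k = "length xs div 2"
  have L: "3 \<le> length xs" "distinct xs" using xs by (auto simp: cyc_def)
  have in_xs: "xs ! 0 \<in> set xs" "xs ! ?k \<in> set xs" using L by (auto intro!: nth_mem)
  then have W: "xs ! 0 \<in> W" "xs ! ?k \<in> W" using cyc_F_subset[OF xs] by auto
  obtain n where n: "n \<le> g div 2 + g - 2" "(ver (xs ! 0), ver (xs ! ?k)) \<in> E' ^^ n"
    using diameter_E' W_ver W by blast
  have "(xs ! 0, xs ! ?k) \<in> F ^^ n"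
    using relpow_lift'[OF W _ n(2)] inner(2)[OF in_xs(2)] by simp
  then have "\<bar>int 0 - int ?k\<bar> \<le> int n \<or> int (length xs) \<le> \<bar>int 0 - int ?k\<bar> + int n"
    using L by (intro isometric_cycle_relpow[OF iso]) (use cyc_F_subset[OF xs] G in auto)
  then have "?k \<le> n" by auto
  moreover have "3 * g \<le> j * g" using j_ge_3 by simp
  ultimately show ?thesis using n(1) g_ge_3 by linarith
next
  case (through_link n x)
  let ?ys = "rotate n xs"
  have ys: "isometric_cycle G (cycle_graph ?ys)" "set ?ys \<subseteq> pverts G" "distinct ?ys"
    using iso cyc_F_subset[OF xs] G xs by (auto simp: cycle_graph_rotate cyc_def)
  show ?thesis
  proof (rule ring_path.length_le[OF through_link(1)])
    fix a b m assume ab: "a < length xs" "b < length xs" "(x a, x b) \<in> F ^^ m"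
    from through_link(2)
    show "\<bar>int a - int b\<bar> \<le> int m \<or> int (length xs) \<le> \<bar>int a - int b\<bar> + int m"
    proof
      assume "\<forall>i<length xs. x i = ?ys ! i"
      then show ?thesis using isometric_cycle_relpow[OF ys, of a b m] ab G by simp
    next
      assume *: "\<forall>i<length xs. x i = ?ys ! (length xs - 1 - i)"
      have "\<bar>int (length xs - 1 - a) - int (length xs - 1 - b)\<bar> \<le> int m \<or>
          int (length xs) \<le> \<bar>int (length xs - 1 - a) - int (length xs - 1 - b)\<bar> + int m"
        using isometric_cycle_relpow[OF ys, of "length xs - 1 - a" "length xs - 1 - b" m] ab G * by simp
      moreover have "\<bar>int (length xs - 1 - a) - int (length xs - 1 - b)\<bar> = \<bar>int a - int b\<bar>"
        using ab(1,2) by linarith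
      ultimately show ?thesis by simp
    qed
  qed
qed

end

section \<open>The equator\<close>

context ring_of_copies
begin

text \<open>One turn around the ring with \<open>g\<close> vertices per copy: the quotient by
  \<open>g\<close> selects the copy, the remainder the place on the spine.\<close>

definition equatorial :: "'b list" where
  "equatorial = map (\<lambda>n. vtx (n div g) (spine (n mod g))) [0..<j * g]"

text \<open>Absolute counterpart of \<open>height\<close>: copies keep their own numbers, so a link
  may wrap around modulo \<open>j * g\<close>.\<close>

definition coord :: "'b \<Rightarrow> nat" where
  "coord a = cop a * g + level (ver a)"

lemma length_equatorial [simp]: "length equatorial = j * g"
  by (simp add: equatorial_def)

lemma mod_g: "n mod g \<le> g - 1"
proof -
  have "n mod g < g" using g_ge_3 by (intro mod_less_divisor) simp
  then show ?thesis by simp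
qed

lemma equatorial_nth:
  assumes "n < j * g"
  shows "equatorial ! n \<in> W" "cop (equatorial ! n) = n div g" "ver (equatorial ! n) = spine (n mod g)"
proof -
  have "n div g < j" using assms by (simp add: less_mult_imp_div_less)
  from vtx[OF this spine_in_V[OF mod_g]] assms
  show "equatorial ! n \<in> W" "cop (equatorial ! n) = n div g" "ver (equatorial ! n) = spine (n mod g)"
    by (auto simp: equatorial_def)
qed

lemma coord_equatorial: "n < j * g \<Longrightarrow> coord (equatorial ! n) = n"
  by (simp add: coord_def equatorial_nth level_spine[OF mod_g])

lemma coord_less:
  assumes "a \<in> W"
  shows "coord a < j * g"
proof -
  have "coord a < Suc (cop a) * g" using level_less[of "ver a"] by (simp add: coord_def)
  also have "\<dots> \<le> j * g" using W_cop[OF assms] by (intro mult_le_mono1) simp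
  finally show ?thesis .
qed

lemma distinct_equatorial: "distinct equatorial"
  unfolding distinct_conv_nth length_equatorial using coord_equatorial by metis

lemma Suc_mod_block: "Suc (c * g + (g - 1)) = Suc c * g"
  using g_ge_3 by simp

lemma coord_link: "link a b \<Longrightarrow> coord b = Suc (coord a) mod (j * g)"
  by (simp only: coord_def link_def level_u level_v Suc_mod_block mult_mod_left add_0_right)

lemma cyc_equatorial: "cyc F equatorial"
  unfolding cyc_def length_equatorial
proof (intro conjI allI impI)
  have "1 * 3 \<le> j * g" using j_ge_3 g_ge_3 by (intro mult_le_mono) auto
  then show "3 \<le> j * g" by simp
  fix n assume n: "n < j * g"
  let ?m = "Suc n mod (j * g)"
  have m: "?m < j * g" using n by (intro mod_less_divisor) linarith
  note a = equatorial_nth[OF n] and b = equatorial_nth[OF m]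
  have mg: "?m mod g = Suc n mod g" by (rule mod_mod_cancel) simp
  show "(equatorial ! n, equatorial ! ?m) \<in> F"
  proof (cases "Suc (n mod g) = g")
    \<comment> \<open>The spine ends at \<open>v\<close> here and the next arc is a link;
      multiplying by \<open>g\<close> transfers the wrap modulo \<open>j\<close> to one modulo
      \<open>j * g\<close>.\<close>
    case True
    then have 1: "n mod g = g - 1" "Suc n mod g = 0" by (auto simp: mod_Suc)
    have "Suc n = n div g * g + Suc (n mod g)" by simp
    also have "\<dots> = Suc (n div g) * g" unfolding True by simp
    finally have "?m = (Suc (n div g) mod j) * g" by (simp only: mult_mod_left)
    then have "?m div g = Suc (n div g) mod j" using g_ge_3 by simp
    moreover note 1
    ultimately have "link (equatorial ! n) (equatorial ! ?m)"
      using a b mg by (simp add: link_def spine(1) spine(2)[simplified])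
    then show ?thesis using a(1) b(1) by (simp add: F_def)
  next
    case False
    have "Suc n \<noteq> j * g"
    proof
      assume "Suc n = j * g"
      then have "Suc n mod g = 0" by simp
      then show False using False by (simp add: mod_Suc split: if_splits)
    qed
    then have "Suc n < j * g" using n by simp
    then have "?m = Suc n" by simp
    moreover have "Suc n mod g = Suc (n mod g)" "Suc n div g = n div g" 
      using False by (auto simp: mod_Suc div_Suc)
    moreover have "n mod g < g - 1" using False mod_g[of n] g_ge_3 by linarith
    then have "(spine (n mod g), spine (Suc (n mod g))) \<in> E'" by (rule spine(3))
    ultimately show ?thesis using a b unfolding F_def by simp
  qed
qed (rule distinct_equatorial)

lemma coord_step:
  assumes "(a, b) \<in> F"
  shows "coord b = coord a \<or> coord b = Suc (coord a) mod (j * g) \<or> coord a = Suc (coord b) mod (j * g)"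
  using assms
proof (cases rule: F_cases)
  case inner
  have "coord a < j * g" "coord b < j * g" using coord_less F_in_W[OF assms] by auto
  moreover have "coord b \<le> Suc (coord a)" "coord a \<le> Suc (coord b)"
    using inner level_step[OF inner(2)] level_step[OF E'_sym[OF inner(2)]] by (auto simp: coord_def)
  ultimately show ?thesis by (metis le_Suc_eq le_antisym mod_less)
qed (auto dest: coord_link)

text \<open>Sending a vertex to the vertex of the equatorial cycle with the same coordinate retracts the
  whole graph onto that cycle without increasing distances.\<close>

lemma isometric_equatorial:
  assumes G: "pair_graph G" "pverts G = W" "parcs G = F"
  shows "isometric_cycle G (cycle_graph equatorial)"
  unfolding isometric_cycle_def
proof (intro conjI ballI)
  show "cycle_graph equatorial \<in> cycles G"
    unfolding cycles_eq[OF G(1)] using cyc_equatorial G(3) by simp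
  let ?r = "\<lambda>a. equatorial ! coord a"
  let ?C = "cycle_graph equatorial"
  have arc: "(?r a, ?r b) \<in> parcs ?C \<or> ?r a = ?r b" if "(a, b) \<in> F" for a b
    using coord_step[OF that] coord_less F_in_W[OF that]
    unfolding parcs_cycle_graph length_equatorial by fastforce
  have sub: "parcs ?C \<subseteq> F"
    using cyc_equatorial F_sym unfolding parcs_cycle_graph cyc_def by auto
  fix x y assume "x \<in> pverts ?C" "y \<in> pverts ?C"
  then have xy: "?r x = x" "?r y = y" "x \<in> W" "x \<in> pverts ?C"
    using coord_equatorial equatorial_nth(1) by (auto simp: in_set_conv_nth)
  show "graph_dist ?C x y = graph_dist G x y"
  proof (rule antisym)
    show "graph_dist ?C x y \<le> graph_dist G x y"
      using relpow_image[of F ?r "parcs ?C" x y, OF arc] xy G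
      by (intro graph_dist_mono) auto
    show "graph_dist G x y \<le> graph_dist ?C x y"
      using relpow_mono'[OF sub] xy G by (intro graph_dist_mono) auto
  qed
qed

text \<open>The length bound does double duty: it also makes the set of lengths finite, so that
  \<open>Max\<close> is its true maximum.\<close>

lemma equator_eq:
  assumes G: "pair_graph G" "pverts G = W" "parcs G = F"
  shows "equator G = j * g"
  unfolding equator_def
proof (rule Max_eqI)
  have bound: "l \<le> j * g" if l: "l \<in> {cycle_length C | C. isometric_cycle G C}" for l
  proof -
    obtain C where C: "isometric_cycle G C" "l = cycle_length C" using l by blast
    then obtain xs where xs: "cyc F xs" "C = cycle_graph xs"
      unfolding isometric_cycle_def cycles_eq[OF G(1)] G(3) by blast
    have "length xs \<le> j * g"
      by (rule isometric_cycle_length_le[OF G(2,3) xs(1)]) (use C xs in simp)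
    then show ?thesis using C xs by (simp add: cycle_length_cycle_graph cyc_def)
  qed
  then show "\<And>l. l \<in> {cycle_length C | C. isometric_cycle G C} \<Longrightarrow> l \<le> j * g" .
  show "finite {cycle_length C | C. isometric_cycle G C}"
    by (rule finite_subset[of _ "{..j * g}"]) (use bound in auto)
  have "cycle_length (cycle_graph equatorial) = j * g"
    by (simp add: cycle_length_cycle_graph distinct_equatorial)
  then show "j * g \<in> {cycle_length C | C. isometric_cycle G C}"
    using isometric_equatorial[OF G] by (intro CollectI exI[of _ "cycle_graph equatorial"]) auto
qed

text \<open>Applied to a cycle of length \<open>g\<close> that the cut leaves intact, this shows
  that the ring attains girth \<open>g\<close>.\<close>

lemma cyc_copy:
  assumes "cyc E' c"
  shows "cyc F (map (vtx 0) c)"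
proof -
  have j: "0 < j" using j_ge_3 by simp
  have V: "set c \<subseteq> V" using assms E_in_V unfolding cyc_def by (metis DiffD1 in_set_conv_nth subsetI)
  have "inj_on (vtx 0) (set c)"
    using V vtx(3)[OF j] by (intro inj_onI) (metis subsetD)
  moreover have "(vtx 0 x, vtx 0 y) \<in> F" if "(x, y) \<in> E'" for x y
    using that vtx[OF j] E_in_V[of x y] by (auto simp: F_def)
  moreover have "Suc i mod length c < length c" if "i < length c" for i
    using that by (intro mod_less_divisor) linarith
  ultimately show ?thesis using assms by (simp add: cyc_def distinct_map)
qed

end

section \<open>Assembling the ring from a Moore graph\<close>

theorem theorem10:
  fixes j g \<delta> q :: nat
  assumes "3 \<le> j" and "0 < g" and "3 \<le> \<delta>"
    and "\<exists>H :: 'a pair_pre_digraph. moore_graph \<delta> g H"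
    and "q = j * g"
  shows "\<exists>G :: nat pair_pre_digraph.
           pair_graph G \<and> regular \<delta> G \<and> girth G = enat g \<and> equator G = q \<and>
           real (card (pverts G)) = real q / real g * real (moore_bound \<delta> g)"
proof -
  obtain H :: "'a pair_pre_digraph" where H: "pair_graph H" "girth H = enat g"
    "min_degree H = \<delta>" "card (pverts H) = moore_bound \<delta> g"
    using assms(4) by (auto simp: moore_graph_def)
  define V E where "V = pverts H" and "E = parcs H"
  note girth = girth_eqD[OF H(1,2), folded E_def]
  obtain c where c: "cyc E c" "length c = g" using girth(2) by blast
  interpret H: simple_graph V E using pair_graphD[OF H(1)] by (simp add: V_def E_def)
  interpret H: moore_graph_rel V E g \<delta>
  proof unfold_locales
    show "cyc E c \<Longrightarrow> g \<le> length c" for c by (rule girth(1))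
    show "3 \<le> g" using c by (simp add: cyc_def)
    show "\<delta> \<le> card (E `` {x})" if "x \<in> V" for x
      unfolding H(3)[symmetric] min_degree_def out_degree_eq E_def[symmetric] V_def[symmetric]
      by (rule Min_le) (use that H.finite_V in auto)
    show "card V = moore_bound \<delta> g" using H(4) by (simp add: V_def)
  qed (rule assms(3))
  define w where "w = c ! 0"
  have g3: "3 \<le> g" by (rule H.g_ge_3)
  have "(c ! 0, c ! (Suc 0 mod length c)) \<in> E"
    using c g3 unfolding cyc_def by (metis less_le_trans zero_less_numeral)
  then have wV: "w \<in> V" using H.E_in_V by (simp add: w_def)
  \<comment> \<open>The degree of \<open>w\<close> is at least three and the cycle uses two of its
    edges, so an edge off the cycle is available for the cut.\<close>
  have "\<not> E `` {w} \<subseteq> {c ! 1, c ! (g - 1)}"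
  proof
    assume "E `` {w} \<subseteq> {c ! 1, c ! (g - 1)}"
    then have "card (E `` {w}) \<le> card {c ! 1, c ! (g - 1)}" by (intro card_mono) auto
    also have "\<dots> \<le> 2" by (simp add: card_insert_if)
    finally show False using H.degree_eq[OF wV] assms(3) by simp
  qed
  then obtain x where x: "(w, x) \<in> E" "x \<noteq> c ! 1" "x \<noteq> c ! (g - 1)" by blast
  have cut: "cyc (E - {(w, x), (x, w)}) c"
  proof -
    have "(c ! i, c ! (Suc i mod g)) \<notin> {(w, x), (x, w)}" if "i < g" for i
    proof -
      have lt: "Suc i mod g < g" using that by (intro mod_less_divisor) linarith
      \<comment> \<open>As \<open>w\<close> occurs only at index \<open>0\<close>, the arcs of
        \<open>c\<close> at \<open>w\<close> join it to \<open>c ! 1\<close> and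
        \<open>c ! (g - 1)\<close>, both different from \<open>x\<close>.\<close>
      have inj: "c ! k = w \<longleftrightarrow> k = 0" if "k < g" for k
        using that c g3 unfolding w_def by (subst nth_eq_iff_index_eq) (auto simp: cyc_def)
      have "c ! i = w \<Longrightarrow> c ! (Suc i mod g) \<noteq> x" using inj[OF that] x g3 by auto
      moreover have "c ! (Suc i mod g) = w \<Longrightarrow> c ! i \<noteq> x"
        using inj[OF lt] x that by (auto simp: mod_Suc split: if_splits)
      ultimately show ?thesis by auto
    qed
    then show ?thesis using c by (simp add: cyc_def)
  qed
  interpret H: cut_graph V E g w x
  proof unfold_locales
    show "(w, x) \<in> E" by (rule x(1))
    \<comment> \<open>By the girth bound a detour has at least \<open>g - 1\<close> arcs, so this
      one has exactly that many.\<close>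
    obtain n where n: "n \<le> g - 1" "(w, x) \<in> (E - {(w, x), (x, w)}) ^^ n"
      using H.edge_detour[OF x(1)] by blast
    then show "(w, x) \<in> (E - {(w, x), (x, w)}) ^^ (g - 1)"
      using H.detour_ge[OF x(1) n(2)] by simp
    show "\<exists>n\<le>g div 2. (y, z) \<in> E ^^ n" if "y \<in> V" "z \<in> V" for y z
      using H.diameter_le that by blast
  qed
  \<comment> \<open>Numbering the pairs of copy and vertex gives a graph on natural numbers,
    whatever the vertex type of \<open>H\<close>.\<close>
  let ?M = "{..<j} \<times> V"
  have "finite ?M" using H.finite_V by simp
  then obtain h where h: "bij_betw h {0..<card ?M} ?M" using ex_bij_betw_nat_finite by blast
  define W where "W = {0..<card ?M}"
  interpret R: ring_of_copies V E g w x j "\<lambda>a. fst (h a)" "\<lambda>a. snd (h a)" W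
    by unfold_locales (use assms(1) h in \<open>auto simp: W_def\<close>)
  define G where "G = \<lparr>pverts = W, parcs = R.F\<rparr>"
  have G: "pverts G = W" "parcs G = R.F" by (simp_all add: G_def)
  have pg: "pair_graph G" by (rule pair_graphI) (use R.simple_graph_F G in simp)
  moreover have "regular \<delta> G"
    unfolding regular_def out_degree_eq G using R.degree_F R.W_ver H.degree_eq by simp
  moreover have "girth G = enat g"
    by (rule girth_eqI[OF pg _ R.cyc_copy[OF cut, folded G(2)]]) (use c R.girth_F G in auto)
  moreover have "equator G = q" using R.equator_eq[OF pg G] assms(5) by simp
  moreover have "real (card (pverts G)) = real q / real g * real (moore_bound \<delta> g)"
    using R.card_W H.card_V assms(2,5) G by simp
  ultimately show ?thesis by blast
qed

end
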